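(* Assume: (A1) $\psi$ is proper, closed and convex, $\mathrm{dom}(F)\neq\emptyset$, and $F^\star:=\inf_x F(x)>-\infty$; (A2) $\mathbb{E}_\xi[\|\nabla f_\xi(x)-\nabla f_\xi(y)\|^2]\le L^2\|x-y\|^2$ for all $x,y\in\mathrm{dom}(F)$, with $L\in(0,\infty)$; (A3) $\mathbb{E}_\xi[\|\nabla f_\xi(x)-\nabla f(x)\|^2]\le\sigma^2$ for all $x\in\mathrm{dom}(F)$, with $\sigma\in[0,\infty)$. Let $\{x_t\}_{t=0}^m$ be generated by the ProxHSGD algorithm (single-sample version, see context) applied to $\min_xF(x)$ with $\beta_t=\beta:=1-\frac{1}{[\tilde b(m+1)]^{1/2}}\in(0,1)$, $\eta_t=\eta\in(0,\frac1L)$, $\delta:=\frac2\eta-2L>0$, and $$\gamma_m:=\frac{\delta}{L},\qquad \gamma_t:=\frac{\delta}{L+L(1+L^2\eta^2)\big[\beta^2\gamma_{t+1}+\beta^4\gamma_{t+2}+\cdots+\beta^{2(m-t)}\gamma_m\big]},\quad t=0,\dots,m-1,$$ where $\eta$ is such that $\gamma_t\in(0,1]$ for all $t$ (i.e. $\delta\le L$). Then: (a) If $\Sigma_m:=\sum_{t=0}^m\gamma_t$ and $\overline{x}_m$ is chosen at random from $\{x_t\}_{t=0}^m$ with $\mathbb{P}(\overline{x}_m=x_t)=\gamma_t/\Sigma_m$, then $$\mathbb{E}\big[\|\mathcal{G}_\eta(\overline{x}_m)\|^2\big]\le\frac{8\sqrt2\,\big(L+\sqrt{\delta L}\,[\tilde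 b(m+1)]^{1/4}\big)}{L\eta^2\delta(m+1)}[F(x_0)-F^\star]+\frac{8\sigma^2}{L^2\eta^2[\tilde b(m+1)]^{1/2}}.$$ (b) Let $\tilde b:=c_1^2(m+1)^{1/3}$ for $c_1\ge\frac1{(m+1)^{2/3}}$. Then, for any $\varepsilon>0$, the number of iterations $m$ needed to guarantee $\mathbb{E}[\|\mathcal{G}_\eta(\overline{x}_m)\|^2]\le\varepsilon^2$ does not exceed $$m:=\Big\lfloor\frac{\Delta_0^{3/2}}{\varepsilon^3}\Big\rfloor,\qquad \Delta_0:=\frac{8}{L^2\eta^2}\Big[\frac{\sqrt2L(L+\sqrt{c_1L\delta})}{\delta}[F(x_0)-F^\star]+\frac{\sigma^2}{c_1}\Big].$$ This is also the total number of proximal operations $\mathrm{prox}_{\eta\psi}$, and the number $\mathcal{T}_m$ of stochastic gradient evaluations is at most $\mathcal{T}_m:=\Big\lfloor\frac{c_1^2\Delta_0^{1/2}}{\varepsilon}+\frac{3\Delta_0^{3/2}}{\varepsilon^3}\Big\rfloor$.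
   Context: Problem: minimize $F(x):=f(x)+\psi(x)$ over $x\in\mathbb{R}^p$, where $f(x)=\mathbb{E}_{\xi\sim\mathbb{P}}[f_\xi(x)]$, each $f_\xi:\mathbb{R}^p\to\mathbb{R}$ is smooth (possibly nonconvex), stochastic gradients are unbiased ($\mathbb{E}_\xi[\nabla f_\xi(x)]=\nabla f(x)$), and $\psi:\mathbb{R}^p\to\mathbb{R}\cup\{+\infty\}$. Proximal operator: $\mathrm{prox}_{\eta\psi}(x):=\arg\min_u\{\eta\psi(u)+\frac12\|u-x\|^2\}$. Gradient mapping: $\mathcal{G}_\eta(x):=\frac1\eta\big(x-\mathrm{prox}_{\eta\psi}(x-\eta\nabla f(x))\big)$. ProxHSGD algorithm: inputs $x_0\in\mathrm{dom}(F)$ (deterministic), $\tilde b\in\mathbb{N}_+$, $\beta_t\in(0,1)$, $\gamma_t\in(0,1]$, $\eta_t>0$. Compute $v_0:=\frac1{\tilde b}\sum_{\tilde\xi_i\in\widetilde{\mathcal{B}}}\nabla f_{\tilde\xi_i}(x_0)$ with $\widetilde{\mathcal B}$ a batch of $\tilde b$ i.i.d. samples of $\xi$; set $\widehat{x}_1:=\mathrm{prox}_{\eta_0\psi}(x_0-\eta_0v_0)$ and $x_1:=(1-\gamma_0)x_0+\gamma_0\widehat{x}_1$. For $t=1,\dots,m$: draw two independent samples $\xi_t,\zeta_t$ of $\xi$, independent of the past; set $$v_t:=\beta_{t-1}v_{t-1}+\beta_{t-1}[\nabla f_{\xi_t}(x_t)-\nabla f_{\xi_t}(x_{t-1})]+(1-\beta_{t-1})\nabla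 f_{\zeta_t}(x_t);$$ set $\widehat{x}_{t+1}:=\mathrm{prox}_{\eta_t\psi}(x_t-\eta_tv_t)$ and $x_{t+1}:=(1-\gamma_t)x_t+\gamma_t\widehat{x}_{t+1}$. $\mathbb{E}[\cdot]$ is expectation over all randomness, including the independent random choice of $\overline{x}_m$. Convention on counts in (b): integer rounding is ignored, i.e. $\tilde b$ and $m+1$ are identified with the real expressions given ($m+1=\Delta_0^{3/2}/\varepsilon^3$), the number of proximal operations is identified with the number of iterations, and the number of stochastic gradient evaluations is counted as $\tilde b+3(m+1)$. *)

theory Defs
  imports "HOL-Probability.Probability"
begin

definition grad :: "('a::euclidean_space \<Rightarrow> real) \<Rightarrow> 'a \<Rightarrow> 'a" where
  "grad g x = (THE d. GDERIV g x :> d)"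

definition smooth_fun :: "('a::euclidean_space \<Rightarrow> real) \<Rightarrow> bool" where
  "smooth_fun g \<longleftrightarrow> (\<forall>x. g differentiable (at x)) \<and> continuous_on UNIV (grad g)"

definition edom :: "('a \<Rightarrow> ereal) \<Rightarrow> 'a set" where
  "edom g = {x. g x < \<infinity>}"

definition epi :: "('a \<Rightarrow> ereal) \<Rightarrow> ('a \<times> real) set" where
  "epi g = {(x, r). g x \<le> ereal r}"

definition proper_fun :: "('a \<Rightarrow> ereal) \<Rightarrow> bool" where
  "proper_fun g \<longleftrightarrow> (\<forall>x. g x \<noteq> - \<infinity>) \<and> edom g \<noteq> {}"

definition closed_fun :: "('a::euclidean_space \<Rightarrow> ereal) \<Rightarrow> bool" where
  "closed_fun g \<longleftrightarrow> closed (epi g)"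

definition convex_fun :: "('a::euclidean_space \<Rightarrow> ereal) \<Rightarrow> bool" where
  "convex_fun g \<longleftrightarrow> convex (epi g)"

definition prox :: "real \<Rightarrow> ('a::euclidean_space \<Rightarrow> ereal) \<Rightarrow> 'a \<Rightarrow> 'a" where
  "prox \<eta> \<psi> x = arg_min (\<lambda>u. ereal \<eta> * \<psi> u + ereal ((norm (u - x))\<^sup>2 / 2)) (\<lambda>_. True)"

definition grad_map ::
  "real \<Rightarrow> ('a::euclidean_space \<Rightarrow> real) \<Rightarrow> ('a \<Rightarrow> ereal) \<Rightarrow> 'a \<Rightarrow> 'a" where
  "grad_map \<eta> f \<psi> x = (1 / \<eta>) *\<^sub>R (x - prox \<eta> \<psi> (x - \<eta> *\<^sub>R grad f x))"

text \<open>
  Labels of the random samples drawn in a run: the members of the initial batch and the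
  two samples \<open>\<xi>\<^sub>t\<close>, \<open>\<zeta>\<^sub>t\<close> of step \<open>t \<ge> 1\<close>.
\<close>

datatype sample_label = Init nat | Xi nat | Zeta nat

definition sample_labels :: "nat \<Rightarrow> nat \<Rightarrow> sample_label set" where
  "sample_labels b m = Init ` {..<b} \<union> Xi ` {1..m} \<union> Zeta ` {1..m}"

definition iid_samples ::
  "'w measure \<Rightarrow> 's measure \<Rightarrow> sample_label set \<Rightarrow> (sample_label \<Rightarrow> 'w \<Rightarrow> 's) \<Rightarrow> bool" where
  "iid_samples M P I S \<longleftrightarrow>
     prob_space.indep_vars M (\<lambda>_. P) S I \<and> (\<forall>i\<in>I. distr M P (S i) = P)"

text \<open>
  Independence of two random variables with possibly different value types, for which the
  library's \<open>indep_var\<close> is not available.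
\<close>

definition indep_pair ::
  "'w measure \<Rightarrow> 'c measure \<Rightarrow> ('w \<Rightarrow> 'c) \<Rightarrow> 'd measure \<Rightarrow> ('w \<Rightarrow> 'd) \<Rightarrow> bool" where
  "indep_pair M N X N' Y \<longleftrightarrow>
     X \<in> measurable M N \<and> Y \<in> measurable M N' \<and>
     prob_space.indep_set M {X -` A \<inter> space M | A. A \<in> sets N} {Y -` B \<inter> space M | B. B \<in> sets N'}"

text \<open>
  ProxHSGD along one realisation \<open>s\<close> of the samples: iterates \<open>x\<^sub>t\<close> and gradient estimators
  \<open>v\<^sub>t\<close>; the point \<open>prox (\<eta> t) \<psi> (x\<^sub>t - \<eta>\<^sub>t v\<^sub>t)\<close> is the intermediate iterate with index \<open>t + 1\<close>.
\<close>

function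
  hsgd_x :: "('s \<Rightarrow> 'a::euclidean_space \<Rightarrow> real) \<Rightarrow> ('a \<Rightarrow> ereal) \<Rightarrow> 'a \<Rightarrow> nat \<Rightarrow>
    (nat \<Rightarrow> real) \<Rightarrow> (nat \<Rightarrow> real) \<Rightarrow> (nat \<Rightarrow> real) \<Rightarrow> (sample_label \<Rightarrow> 's) \<Rightarrow> nat \<Rightarrow> 'a" and
  hsgd_v :: "('s \<Rightarrow> 'a::euclidean_space \<Rightarrow> real) \<Rightarrow> ('a \<Rightarrow> ereal) \<Rightarrow> 'a \<Rightarrow> nat \<Rightarrow>
    (nat \<Rightarrow> real) \<Rightarrow> (nat \<Rightarrow> real) \<Rightarrow> (nat \<Rightarrow> real) \<Rightarrow> (sample_label \<Rightarrow> 's) \<Rightarrow> nat \<Rightarrow> 'a"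
where
  "hsgd_x fs \<psi> x0 b \<beta> \<gamma> \<eta> s 0 = x0"
| "hsgd_x fs \<psi> x0 b \<beta> \<gamma> \<eta> s (Suc t) =
     (1 - \<gamma> t) *\<^sub>R hsgd_x fs \<psi> x0 b \<beta> \<gamma> \<eta> s t +
     \<gamma> t *\<^sub>R prox (\<eta> t) \<psi>
       (hsgd_x fs \<psi> x0 b \<beta> \<gamma> \<eta> s t - \<eta> t *\<^sub>R hsgd_v fs \<psi> x0 b \<beta> \<gamma> \<eta> s t)"
| "hsgd_v fs \<psi> x0 b \<beta> \<gamma> \<eta> s 0 = (1 / real b) *\<^sub>R (\<Sum>i<b. grad (fs (s (Init i))) x0)"
| "hsgd_v fs \<psi> x0 b \<beta> \<gamma> \<eta> s (Suc t) =
     \<beta> t *\<^sub>R hsgd_v fs \<psi> x0 b \<beta> \<gamma> \<eta> s t +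
     \<beta> t *\<^sub>R (grad (fs (s (Xi (Suc t)))) (hsgd_x fs \<psi> x0 b \<beta> \<gamma> \<eta> s (Suc t)) -
            grad (fs (s (Xi (Suc t)))) (hsgd_x fs \<psi> x0 b \<beta> \<gamma> \<eta> s t)) +
     (1 - \<beta> t) *\<^sub>R grad (fs (s (Zeta (Suc t)))) (hsgd_x fs \<psi> x0 b \<beta> \<gamma> \<eta> s (Suc t))"
  by pat_completeness auto
termination
  by (relation "Wellfounded.measure (case_sum
        (\<lambda>(_, _, _, _, _, _, _, _, t). 2 * t) (\<lambda>(_, _, _, _, _, _, _, _, t). 2 * t + 1))") auto

text \<open>One proximal step for each \<open>t = 0, \<dots>, m\<close>.\<close>

definition prox_ops :: "nat \<Rightarrow> nat" where
  "prox_ops m = m + 1"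

text \<open>The initial batch plus three evaluations per step; the step \<open>t = 0\<close> is charged as well.\<close>

definition sgrad_evals :: "nat \<Rightarrow> nat \<Rightarrow> nat" where
  "sgrad_evals b m = b + 3 * (m + 1)"

end

theory Submission
  imports Defs
begin

text \<open>
  One proximal step decreases \<open>F\<close> up to the squared estimator error
  \<open>e\<^sub>t = \<parallel>v\<^sub>t - \<nabla>f(x\<^sub>t)\<parallel>\<^sup>2\<close>; summed along a path this bounds
  \<open>\<Sum>\<^sub>t \<gamma>\<^sub>t (L\<eta>\<^sup>2/8 \<parallel>\<G>(x\<^sub>t)\<parallel>\<^sup>2 + C\<^sub>t d\<^sub>t)\<close> by \<open>F(x\<^sub>0) - F\<^sup>\<star> + \<kappa> \<Sum>\<^sub>t \<gamma>\<^sub>t e\<^sub>t\<close>,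
  where \<open>d\<^sub>t\<close> is the squared length of the proximal step. Independence of the fresh samples gives
  \<open>\<E> e\<^sub>t\<^sub>+\<^sub>1 \<le> \<beta>\<^sup>2 \<E> e\<^sub>t + \<beta>\<^sup>2 L\<^sup>2 \<gamma>\<^sub>t\<^sup>2 \<E> d\<^sub>t + (1 - \<beta>)\<^sup>2 \<sigma>\<^sup>2\<close>.
  Summation by parts against the discounted tails \<open>R\<^sub>t = \<gamma>\<^sub>t + \<beta>\<^sup>2 R\<^sub>t\<^sub>+\<^sub>1\<close> turns \<open>\<Sum> \<gamma>\<^sub>t \<E> e\<^sub>t\<close>
  into \<open>R\<^sub>0 \<E> e\<^sub>0\<close> plus terms in \<open>d\<^sub>t\<close> which the recursion for \<open>\<gamma>\<close> makes small enough to be absorbed by \<open>C\<^sub>t d\<^sub>t\<close>.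
  What remains are a lower bound on \<open>\<Sum> \<gamma>\<^sub>t\<close> (arithmetic-harmonic mean) and an upper bound on \<open>R\<^sub>0\<close>
  (convexity of the recursion map).
\<close>

section \<open>Proximal gradient steps\<close>

text \<open>No finiteness of moments is assumed for the estimators along the run, so integrability
  of the errors and step lengths has to be proved together with the bounds: the pathwise inequality
  controls a step length by earlier errors, because \<open>F\<close> is bounded below, and the error
  recursion then controls the next error. For this reason the error recursion is stated with
  nonnegative integrals before it becomes one for expectations. The rule for \<gamma> is dictated by
  absorption: it makes the coefficient of each step length proportional to \<open>\<gamma> t\<close>
  times the next discounted tail, the very weight which summation by parts puts on that length. At
  the last step this coefficient is zero, and the recursion up to \<open>m\<close> involves only
  step lengths with index below \<open>m\<close>. The choice of \<beta> balances two noise sources.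
  The batch error \<sigma>^2/b enters with the weight of the whole tail at time 0, the fresh noise
  with (1 - \<beta>)^2 times the sum of all tails; both are then of order (1 - \<beta>) times the
  total weight, which cancels when the average is taken.\<close>

lemma GDERIV_grad:
  fixes g :: "'a::euclidean_space \<Rightarrow> real"
  assumes "g differentiable (at x)"
  shows "GDERIV g x :> grad g x"
proof -
  obtain g' where g': "(g has_derivative g') (at x)"
    using assms by (auto simp: differentiable_def)
  have lin: "linear g'"
    using g' by (rule has_derivative_linear)
  \<comment> \<open>The Riesz representative of the derivative in coordinates. Uniqueness is shown
    as well because \<open>grad\<close> is a definite description.\<close>
  define D where "D = (\<Sum>i\<in>Basis. g' i *\<^sub>R i)"
  have "g' h = inner h D" for h
  proof -
    have "g' h = g' (\<Sum>i\<in>Basis. inner h i *\<^sub>R i)"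
      by (simp add: euclidean_representation)
    also have "\<dots> = (\<Sum>i\<in>Basis. inner h i * g' i)"
      by (simp add: linear_sum[OF lin] linear_cmul[OF lin])
    also have "\<dots> = inner h D"
      by (simp add: D_def inner_sum_right mult.commute)
    finally show ?thesis .
  qed
  then have "GDERIV g x :> D"
    using g' unfolding gderiv_def by presburger
  moreover have "E = D" if "GDERIV g x :> E" for E
  proof -
    have "(\<lambda>h. inner h E) = (\<lambda>h. inner h D)"
      using that \<open>GDERIV g x :> D\<close> unfolding gderiv_def by (rule has_derivative_unique)
    then have "inner h E = inner h D" for h
      by (rule fun_cong)
    then have "inner h (E - D) = 0" for h
      by (simp add: inner_diff_right)
    from this[of "E - D"] show ?thesis by simp
  qed
  ultimately show ?thesis
    unfolding grad_def by (metis the_equality)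
qed

text \<open>The comparison function \<open>\<phi>\<close> has nonpositive derivative on [0, 1].
  Points of the segment stay in \<open>C\<close>, so the Lipschitz bound is called only on
  \<open>C\<close>; this will be \<open>edom \<psi>\<close>, where the assumptions control
  gradients.\<close>

lemma descent_lemma:
  fixes f :: "'a::euclidean_space \<Rightarrow> real"
  assumes C: "convex C" and y: "y \<in> C" and z: "z \<in> C"
    and diff: "\<And>u. f differentiable (at u)"
    and lip: "\<And>u w. u \<in> C \<Longrightarrow> w \<in> C \<Longrightarrow> norm (grad f u - grad f w) \<le> L * norm (u - w)"
  shows "f z \<le> f y + inner (grad f y) (z - y) + L / 2 * (norm (z - y))\<^sup>2"
proof -
  define d where "d = z - y"
  define \<phi> where "\<phi> t = f (y + t *\<^sub>R d) - t * inner (grad f y) d - L / 2 * t\<^sup>2 * (norm d)\<^sup>2" for t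
  have der: "\<exists>D. (\<phi> has_real_derivative D) (at t) \<and> D \<le> 0" if t: "0 \<le> t" "t \<le> 1" for t
  proof -
    define u where "u = y + t *\<^sub>R d"
    have "u = (1 - t) *\<^sub>R y + t *\<^sub>R z"
      by (simp add: u_def d_def algebra_simps)
    then have u: "u \<in> C"
      using C y z t by (simp add: convexD)
    have 1: "((\<lambda>t. y + t *\<^sub>R d) has_derivative (\<lambda>h. h *\<^sub>R d)) (at t)"
      by (auto intro!: derivative_eq_intros)
    have "(f has_derivative (\<lambda>h. inner h (grad f u))) (at (y + t *\<^sub>R d))"
      using GDERIV_grad[OF diff, of u] by (simp add: gderiv_def u_def)
    from has_derivative_compose[OF 1 this]
    have 2: "((\<lambda>t. f (y + t *\<^sub>R d)) has_real_derivative inner d (grad f u)) (at t)"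
      by (simp add: has_field_derivative_def mult_commute_abs)
    have "(\<phi> has_real_derivative
        (inner d (grad f u) - inner (grad f y) d - L * t * (norm d)\<^sup>2)) (at t)"
      unfolding \<phi>_def by (rule derivative_eq_intros 2 refl | simp)+
    moreover have "inner d (grad f u) - inner (grad f y) d = inner (grad f u - grad f y) d"
      by (simp add: inner_diff_left inner_diff_right inner_commute)
    moreover have "inner (grad f u - grad f y) d \<le> L * t * (norm d)\<^sup>2"
    proof -
      have "inner (grad f u - grad f y) d \<le> norm (grad f u - grad f y) * norm d"
        by (rule norm_cauchy_schwarz)
      also have "\<dots> \<le> L * norm (u - y) * norm d"
        by (intro mult_right_mono lip u y) simp
      also have "\<dots> = L * t * (norm d)\<^sup>2"
        using t by (simp add: u_def power2_eq_square)
      finally show ?thesis .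
    qed
    ultimately show ?thesis by fastforce
  qed
  have "\<phi> 1 \<le> \<phi> 0"
    by (rule DERIV_nonpos_imp_nonincreasing[of 0 1]) (use der in auto)
  then show ?thesis
    by (simp add: \<phi>_def d_def)
qed

text \<open>Above 1 the constant \<open>B\<close> is dominated by \<open>B * n\<close>, which
  reduces the quadratic inequality to a linear one. This provides an explicit radius for sublevel
  sets.\<close>

lemma quadratic_bound_imp_bounded:
  fixes n :: real
  assumes "0 < a" "0 \<le> n" "0 \<le> B" "0 \<le> C" "a * n\<^sup>2 \<le> B + C * n"
  shows "n \<le> 1 + (B + C) / a"
proof (rule ccontr)
  assume *: "\<not> ?thesis"
  have "0 \<le> (B + C) / a" using assms by simp
  with * have n: "1 < n" "(B + C) / a < n" by auto
  then have "B + C < a * n" using assms by (simp add: field_simps)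
  then have "(B + C) * n < a * n * n" using n by simp
  moreover have "B \<le> B * n" using n assms by (simp add: mult_le_cancel_left1)
  ultimately have "B + C * n < a * n\<^sup>2" by (simp add: algebra_simps power2_eq_square)
  with assms show False by simp
qed

section \<open>Extended-valued convex functions and their proximal operator\<close>

lemma edom_real:
  assumes "proper_fun \<psi>" "u \<in> edom \<psi>"
  shows "\<psi> u = ereal (real_of_ereal (\<psi> u))"
  using assms by (cases "\<psi> u") (auto simp: edom_def proper_fun_def)

text \<open>Both claims come from one convex combination of epigraph points: its height is a real
  upper bound for \<open>\<psi>\<close>, which gives finiteness and the inequality at once.\<close>

lemma edom_convex_comb:
  fixes \<psi> :: "'a::euclidean_space \<Rightarrow> ereal"
  assumes proper: "proper_fun \<psi>" and convex: "convex_fun \<psi>"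
    and u: "u \<in> edom \<psi>" and y: "y \<in> edom \<psi>" and t: "0 \<le> t" "t \<le> 1"
  shows "(1 - t) *\<^sub>R u + t *\<^sub>R y \<in> edom \<psi>"
    and "real_of_ereal (\<psi> ((1 - t) *\<^sub>R u + t *\<^sub>R y))
      \<le> (1 - t) * real_of_ereal (\<psi> u) + t * real_of_ereal (\<psi> y)"
proof -
  have "(u, real_of_ereal (\<psi> u)) \<in> epi \<psi>" "(y, real_of_ereal (\<psi> y)) \<in> epi \<psi>"
    using edom_real[OF proper u] edom_real[OF proper y] by (simp_all add: epi_def)
  then have "(1 - t) *\<^sub>R (u, real_of_ereal (\<psi> u)) + t *\<^sub>R (y, real_of_ereal (\<psi> y)) \<in> epi \<psi>"
    using convex t by (intro convexD) (auto simp: convex_fun_def)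
  then have *: "\<psi> ((1 - t) *\<^sub>R u + t *\<^sub>R y)
      \<le> ereal ((1 - t) * real_of_ereal (\<psi> u) + t * real_of_ereal (\<psi> y))"
    by (simp add: epi_def)
  then show d: "(1 - t) *\<^sub>R u + t *\<^sub>R y \<in> edom \<psi>"
    by (auto simp: edom_def intro: le_less_trans)
  show "real_of_ereal (\<psi> ((1 - t) *\<^sub>R u + t *\<^sub>R y))
      \<le> (1 - t) * real_of_ereal (\<psi> u) + t * real_of_ereal (\<psi> y)"
    using * edom_real[OF proper d] by (metis ereal_less_eq(3))
qed

text \<open>Separation would give an affine minorant of \<open>\<psi>\<close>; a concave quadratic
  one is enough here and easier to get. Scaled by \<open>\<eta>\<close> and added to half the
  squared distance it still has curvature \<open>1 - \<eta> * C > 0\<close>.\<close>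

locale prox_wellposed =
  fixes \<psi> :: "'a::euclidean_space \<Rightarrow> ereal" and \<eta> :: real and A C :: real and w z :: 'a
  assumes proper: "proper_fun \<psi>" and closed: "closed_fun \<psi>" and convex: "convex_fun \<psi>"
    and eta: "0 < \<eta>" and C: "0 \<le> C" "\<eta> * C < 1"
    and minorant: "\<And>u. ereal (A + inner w (u - z) - C / 2 * (norm (u - z))\<^sup>2) \<le> \<psi> u"
begin

text \<open>On the epigraph the proximal objective becomes the continuous function
  \<open>obj\<close> of a point and a height, so closedness of the epigraph takes the place of lower
  semicontinuity. The sublevel set \<open>K\<close> is closed and lies in a box, hence is
  compact.\<close>

lemma epi_minimizer_exists:
  "\<exists>p r. (p, r) \<in> epi \<psi> \<and>
     (\<forall>(u, k)\<in>epi \<psi>. \<eta> * r + (norm (p - x))\<^sup>2 / 2 \<le> \<eta> * k + (norm (u - x))\<^sup>2 / 2)"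
proof -
  define obj where "obj = (\<lambda>(u, k). \<eta> * k + (norm (u - x))\<^sup>2 / 2)"
  obtain u0 where u0: "u0 \<in> edom \<psi>"
    using proper by (auto simp: proper_fun_def)
  define r0 where "r0 = real_of_ereal (\<psi> u0)"
  have e0: "(u0, r0) \<in> epi \<psi>"
    using edom_real[OF proper u0] by (simp add: epi_def r0_def)
  define c where "c = obj (u0, r0)"
  define K where "K = epi \<psi> \<inter> {s. obj s \<le> c}"
  have cont: "continuous_on UNIV obj"
    unfolding obj_def case_prod_beta by (auto intro!: continuous_intros)
  have "closed {s. obj s \<le> c}"
    by (intro closed_Collect_le cont continuous_on_const)
  then have clK: "closed K"
    using closed by (auto simp: K_def closed_fun_def)
  \<comment> \<open>\<open>\<rho>\<close> is the radius given by
    \<open>quadratic_bound_imp_bounded\<close> for leading coefficient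
    \<open>(1 - \<eta> * C) / 2\<close>; \<open>lo\<close> bounds the minorant from below on that
    ball, hence all heights in \<open>K\<close>.\<close>
  define \<rho> where "\<rho> = 1 + (\<bar>c - \<eta> * A\<bar> + (\<eta> * norm w + norm (z - x))) / ((1 - \<eta> * C) / 2)"
  define lo where "lo = A - norm w * \<rho> - C / 2 * \<rho>\<^sup>2"
  have bd: "u \<in> cball z \<rho> \<and> k \<in> {lo..c / \<eta>}" if "(u, k) \<in> K" for u k
  proof -
    define n where "n = norm (u - z)"
    have k: "A + inner w (u - z) - C / 2 * n\<^sup>2 \<le> k"
      using minorant[of u] that order_trans unfolding K_def epi_def n_def by fastforce
    have ip: "- (norm w * n) \<le> inner w (u - z)"
      using Cauchy_Schwarz_ineq2[of w "u - z"] by (simp add: n_def abs_le_iff)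
    have o: "\<eta> * k + (norm (u - x))\<^sup>2 / 2 \<le> c"
      using that by (simp add: K_def obj_def)
    have sq: "n\<^sup>2 - 2 * n * norm (z - x) \<le> (norm (u - x))\<^sup>2"
    proof -
      have "u - x = (u - z) + (z - x)" by simp
      then have "(norm (u - x))\<^sup>2 = n\<^sup>2 + 2 * inner (u - z) (z - x) + (norm (z - x))\<^sup>2"
        by (simp only: n_def power2_norm_eq_inner)
          (simp add: inner_add_left inner_add_right inner_commute algebra_simps)
      moreover have "- (n * norm (z - x)) \<le> inner (u - z) (z - x)"
        using Cauchy_Schwarz_ineq2[of "u - z" "z - x"] by (simp add: n_def abs_le_iff)
      moreover have "0 \<le> (norm (z - x))\<^sup>2" by simp
      ultimately show ?thesis by linarith
    qed
    have "\<eta> * (A - norm w * n - C / 2 * n\<^sup>2) \<le> \<eta> * k"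
      using k ip eta by (intro mult_left_mono) auto
    with o sq have "(1 - \<eta> * C) / 2 * n\<^sup>2 \<le> (c - \<eta> * A) + (\<eta> * norm w + norm (z - x)) * n"
      by (simp add: algebra_simps diff_divide_distrib)
    then have "(1 - \<eta> * C) / 2 * n\<^sup>2 \<le> \<bar>c - \<eta> * A\<bar> + (\<eta> * norm w + norm (z - x)) * n"
      by linarith
    then have n: "n \<le> \<rho>"
      unfolding \<rho>_def using eta C by (intro quadratic_bound_imp_bounded) (auto simp: n_def)
    have n0: "0 \<le> n" by (simp add: n_def)
    have "norm w * n \<le> norm w * \<rho>" "C / 2 * n\<^sup>2 \<le> C / 2 * \<rho>\<^sup>2"
      using n n0 C by (auto intro!: mult_left_mono power_mono)
    then have "lo \<le> k"
      unfolding lo_def using k ip by linarith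
    moreover have "\<eta> * k \<le> c"
      using o zero_le_power2[of "norm (u - x)"] by linarith
    then have "k \<le> c / \<eta>"
      using eta by (simp add: field_simps)
    ultimately show ?thesis
      using n by (simp add: n_def dist_norm norm_minus_commute)
  qed
  have "K \<subseteq> cball z \<rho> \<times> {lo..c / \<eta>}"
    using bd by auto
  then have "bounded K"
    by (rule bounded_subset[OF bounded_Times, rotated 2]) auto
  with clK have "compact K"
    by (simp add: compact_eq_bounded_closed)
  moreover have "(u0, r0) \<in> K"
    using e0 by (simp add: K_def c_def)
  ultimately obtain s where s: "s \<in> K" "\<And>s'. s' \<in> K \<Longrightarrow> obj s \<le> obj s'"
    using continuous_attains_inf[of K obj] continuous_on_subset[OF cont] by (metis empty_iff subset_UNIV)
  have "obj s \<le> obj s'" if "s' \<in> epi \<psi>" for s'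
    using s that by (cases "obj s' \<le> c") (auto simp: K_def)
  with s(1) show ?thesis
    by (intro exI[of _ "fst s"] exI[of _ "snd s"]) (auto simp: K_def obj_def case_prod_beta)
qed

text \<open>\<open>prox\<close> is a Hilbert choice and carries information only once a minimizer
  exists. The epigraph minimizer \<open>p\<close> supplies one: outside \<open>edom \<psi>\<close>
  the objective is infinite, inside it is compared as a real number.\<close>

lemma prox_edom: "prox \<eta> \<psi> x \<in> edom \<psi>"
  and prox_minimal: "u \<in> edom \<psi> \<Longrightarrow>
    \<eta> * real_of_ereal (\<psi> (prox \<eta> \<psi> x)) + (norm (prox \<eta> \<psi> x - x))\<^sup>2 / 2
      \<le> \<eta> * real_of_ereal (\<psi> u) + (norm (u - x))\<^sup>2 / 2"
proof -
  define obj where "obj = (\<lambda>u. ereal \<eta> * \<psi> u + ereal ((norm (u - x))\<^sup>2 / 2))"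
  obtain p r where p: "(p, r) \<in> epi \<psi>"
    and min: "\<And>u k. (u, k) \<in> epi \<psi> \<Longrightarrow>
      \<eta> * r + (norm (p - x))\<^sup>2 / 2 \<le> \<eta> * k + (norm (u - x))\<^sup>2 / 2"
    using epi_minimizer_exists[of x] by fast
  have pd: "p \<in> edom \<psi>"
    using p by (auto simp: epi_def edom_def intro: le_less_trans)
  have obj_dom: "obj u = ereal (\<eta> * real_of_ereal (\<psi> u) + (norm (u - x))\<^sup>2 / 2)"
    if "u \<in> edom \<psi>" for u
    using edom_real[OF proper that] unfolding obj_def by (metis plus_ereal.simps(1) times_ereal.simps(1))
  have obj_out: "obj u = \<infinity>" if "u \<notin> edom \<psi>" for u
  proof -
    have "\<psi> u = \<infinity>" using that by (auto simp: edom_def)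
    then show ?thesis using eta by (simp add: obj_def)
  qed
  have "\<not> obj u < obj p" for u
  proof (cases "u \<in> edom \<psi>")
    case True
    have "(u, real_of_ereal (\<psi> u)) \<in> epi \<psi>"
      using edom_real[OF proper True] by (simp add: epi_def)
    from min[OF this] have "\<eta> * r + (norm (p - x))\<^sup>2 / 2 \<le> \<eta> * real_of_ereal (\<psi> u) + (norm (u - x))\<^sup>2 / 2" .
    moreover have "real_of_ereal (\<psi> p) \<le> r"
      using p edom_real[OF proper pd] unfolding epi_def by (metis case_prodD ereal_less_eq(3) mem_Collect_eq)
    then have "\<eta> * real_of_ereal (\<psi> p) \<le> \<eta> * r"
      using eta by simp
    ultimately show ?thesis
      by (simp add: obj_dom[OF True] obj_dom[OF pd])
  qed (simp add: obj_out)
  then have "is_arg_min obj (\<lambda>_. True) p"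
    by (simp add: is_arg_min_def)
  then have "is_arg_min obj (\<lambda>_. True) (arg_min obj (\<lambda>_. True))"
    unfolding arg_min_def by (rule someI)
  then have le: "obj (prox \<eta> \<psi> x) \<le> obj u" for u
    by (simp add: is_arg_min_def prox_def obj_def not_less)
  show d: "prox \<eta> \<psi> x \<in> edom \<psi>"
    using le[of p] obj_out[of "prox \<eta> \<psi> x"] obj_dom[OF pd] by fastforce
  show "\<eta> * real_of_ereal (\<psi> (prox \<eta> \<psi> x)) + (norm (prox \<eta> \<psi> x - x))\<^sup>2 / 2
      \<le> \<eta> * real_of_ereal (\<psi> u) + (norm (u - x))\<^sup>2 / 2" if "u \<in> edom \<psi>"
    using le[of u] by (simp add: obj_dom[OF that] obj_dom[OF d])
qed

text \<open>First-order optimality without subdifferentials: comparing \<open>p\<close> with the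
  points of the segment towards \<open>u\<close> gives \<open>0 \<le> t * (A + t * B)\<close>;
  divide by \<open>t\<close> and let \<open>t\<close> tend to 0 from the right.\<close>

lemma prox_variational:
  fixes x :: 'a
  assumes u: "u \<in> edom \<psi>"
  defines "p \<equiv> prox \<eta> \<psi> x"
  shows "\<eta> * real_of_ereal (\<psi> p) \<le> \<eta> * real_of_ereal (\<psi> u) + inner (p - x) (u - p)"
proof -
  define A where "A = \<eta> * real_of_ereal (\<psi> u) - \<eta> * real_of_ereal (\<psi> p) + inner (p - x) (u - p)"
  define B where "B = (norm (u - p))\<^sup>2 / 2"
  have pd: "p \<in> edom \<psi>"
    unfolding p_def by (rule prox_edom)
  have *: "0 \<le> A + t * B" if t: "0 < t" "t \<le> 1" for t
  proof -
    define y where "y = (1 - t) *\<^sub>R p + t *\<^sub>R u"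
    have y: "y \<in> edom \<psi>" "real_of_ereal (\<psi> y) \<le> (1 - t) * real_of_ereal (\<psi> p) + t * real_of_ereal (\<psi> u)"
      unfolding y_def using edom_convex_comb[OF proper convex pd u, of t] t by auto
    have "y - x = (p - x) + t *\<^sub>R (u - p)"
      by (simp add: y_def algebra_simps)
    then have "(norm (y - x))\<^sup>2 = (norm (p - x))\<^sup>2 + 2 * t * inner (p - x) (u - p) + t\<^sup>2 * (norm (u - p))\<^sup>2"
      by (simp only: power2_norm_eq_inner)
        (simp add: inner_add_left inner_add_right inner_commute power2_eq_square algebra_simps)
    moreover have "\<eta> * real_of_ereal (\<psi> p) + (norm (p - x))\<^sup>2 / 2 \<le> \<eta> * real_of_ereal (\<psi> y) + (norm (y - x))\<^sup>2 / 2"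
      unfolding p_def using y(1) by (rule prox_minimal)
    moreover have "\<eta> * real_of_ereal (\<psi> y) \<le> \<eta> * ((1 - t) * real_of_ereal (\<psi> p) + t * real_of_ereal (\<psi> u))"
      using y(2) eta by simp
    ultimately have "0 \<le> t * (A + t * B)"
      by (simp add: A_def B_def algebra_simps power2_eq_square)
    with t show ?thesis by (simp add: zero_le_mult_iff)
  qed
  have "((\<lambda>t. A + t * B) \<longlongrightarrow> A + 0 * B) (at_right 0)"
    by (intro tendsto_intros)
  moreover have "\<forall>\<^sub>F t in at_right (0::real). 0 \<le> A + t * B"
    unfolding eventually_at_right_field by (rule exI[of _ 1]) (auto intro: *)
  ultimately have "0 \<le> A"
    by (intro tendsto_lowerbound[of "\<lambda>t. A + t * B" A "at_right 0" 0]) simp_all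
  then show ?thesis
    by (simp add: A_def)
qed

text \<open>Adding the variational inequalities of the two proximal points, each tested at the
  other, cancels the values of \<open>\<psi>\<close> and leaves firm nonexpansiveness. This later
  also makes the iterates measurable.\<close>

lemma prox_nonexpansive: "norm (prox \<eta> \<psi> x - prox \<eta> \<psi> y) \<le> norm (x - y)"
proof -
  let ?p = "prox \<eta> \<psi> x" and ?r = "prox \<eta> \<psi> y"
  have "0 \<le> inner (?p - x) (?r - ?p) + inner (?r - y) (?p - ?r)"
    using prox_variational[OF prox_edom[of y], of x] prox_variational[OF prox_edom[of x], of y]
    by linarith
  also have "\<dots> = inner (x - y) (?p - ?r) - (norm (?p - ?r))\<^sup>2"
    by (simp add: power2_norm_eq_inner inner_diff_left inner_diff_right inner_commute)
  finally have "(norm (?p - ?r))\<^sup>2 \<le> norm (x - y) * norm (?p - ?r)"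
    using norm_cauchy_schwarz[of "x - y" "?p - ?r"] by linarith
  then show ?thesis
    by (cases "norm (?p - ?r) = 0") (auto simp: power2_eq_square)
qed

end

section \<open>Deterministic estimates for one step on the composite problem\<close>

locale composite_problem =
  fixes f :: "'a::euclidean_space \<Rightarrow> real" and \<psi> :: "'a \<Rightarrow> ereal" and L \<eta> Flow :: real
  assumes f_diff: "\<And>y. f differentiable (at y)"
    and proper: "proper_fun \<psi>" and closed: "closed_fun \<psi>" and convex: "convex_fun \<psi>"
    and L: "0 < L" and eta: "0 < \<eta>" "\<eta> * L < 1"
    and lip: "\<And>y z. y \<in> edom \<psi> \<Longrightarrow> z \<in> edom \<psi> \<Longrightarrow> norm (grad f y - grad f z) \<le> L * norm (y - z)"
    and lower: "\<And>y. y \<in> edom \<psi> \<Longrightarrow> Flow \<le> f y + real_of_ereal (\<psi> y)"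
begin

text \<open>The base point at which the quadratic minorant of \<open>\<psi>\<close> is expanded;
  every domain point would serve.\<close>

definition anchor :: 'a where "anchor = (SOME z. z \<in> edom \<psi>)"

lemma anchor_edom: "anchor \<in> edom \<psi>"
  using proper unfolding anchor_def proper_fun_def by (metis some_in_eq)

lemma edom_convex: "convex (edom \<psi>)"
  unfolding convex_alt by (auto intro!: edom_convex_comb(1)[OF proper convex])

lemma f_descent:
  "y \<in> edom \<psi> \<Longrightarrow> z \<in> edom \<psi> \<Longrightarrow>
    f z \<le> f y + inner (grad f y) (z - y) + L / 2 * (norm (z - y))\<^sup>2"
  by (rule descent_lemma[OF edom_convex _ _ f_diff lip])

text \<open>Since \<open>f\<close> has a quadratic upper bound with coefficient \<open>L / 2\<close>, boundedness of \<open>f + \<psi>\<close> from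
  below gives \<open>\<psi>\<close> a quadratic minorant, and \<open>\<eta> L < 1\<close> makes the proximal objective coercive.\<close>

sublocale prox_wellposed \<psi> \<eta> "Flow - f anchor" L "- grad f anchor" anchor
proof
  fix u
  show "ereal (Flow - f anchor + inner (- grad f anchor) (u - anchor) - L / 2 * (norm (u - anchor))\<^sup>2) \<le> \<psi> u"
  proof (cases "u \<in> edom \<psi>")
    case True
    have "Flow - f anchor + inner (- grad f anchor) (u - anchor) - L / 2 * (norm (u - anchor))\<^sup>2
        \<le> real_of_ereal (\<psi> u)"
      using lower[OF True] f_descent[OF anchor_edom True] by simp
    then show ?thesis
      using edom_real[OF proper True] by (metis ereal_less_eq(3))
  next
    case False
    then show ?thesis by (simp add: edom_def)
  qed
qed (use proper closed convex L eta in auto)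

lemma prox_step_edom:
  assumes "y \<in> edom \<psi>" "0 \<le> \<gamma>" "\<gamma> \<le> 1"
  shows "(1 - \<gamma>) *\<^sub>R y + \<gamma> *\<^sub>R prox \<eta> \<psi> u \<in> edom \<psi>"
  using edom_convex_comb(1)[OF proper convex assms(1) prox_edom assms(2,3)] .

text \<open>Inserts the proximal point of the estimator \<open>v\<close> between \<open>y\<close>
  and the proximal point of the true gradient. Nonexpansiveness bounds the second leg by
  \<open>\<eta>\<close> times the estimator error, and squaring a sum of two terms gives the factors
  2.\<close>

lemma grad_map_le:
  "(\<eta> * norm (grad_map \<eta> f \<psi> y))\<^sup>2
    \<le> 2 * (norm (prox \<eta> \<psi> (y - \<eta> *\<^sub>R v) - y))\<^sup>2 + 2 * \<eta>\<^sup>2 * (norm (v - grad f y))\<^sup>2"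
proof -
  define p where "p = prox \<eta> \<psi> (y - \<eta> *\<^sub>R v)"
  define r where "r = prox \<eta> \<psi> (y - \<eta> *\<^sub>R grad f y)"
  have "\<eta> * norm (grad_map \<eta> f \<psi> y) = norm (y - r)"
    using eta by (simp add: grad_map_def r_def)
  also have "y - r = (y - p) + (p - r)" by simp
  also have "norm \<dots> \<le> norm (y - p) + norm (p - r)"
    by (rule norm_triangle_ineq)
  also have "norm (p - r) \<le> norm ((y - \<eta> *\<^sub>R v) - (y - \<eta> *\<^sub>R grad f y))"
    unfolding p_def r_def by (rule prox_nonexpansive)
  also have "(y - \<eta> *\<^sub>R v) - (y - \<eta> *\<^sub>R grad f y) = - (\<eta> *\<^sub>R (v - grad f y))"
    by (simp add: algebra_simps)
  also have "norm \<dots> = \<eta> * norm (v - grad f y)"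
    using eta by simp
  finally have "\<eta> * norm (grad_map \<eta> f \<psi> y) \<le> norm (p - y) + \<eta> * norm (v - grad f y)"
    by (simp add: norm_minus_commute)
  then have "(\<eta> * norm (grad_map \<eta> f \<psi> y))\<^sup>2 \<le> (norm (p - y) + \<eta> * norm (v - grad f y))\<^sup>2"
    using eta by (intro power_mono) auto
  also have "\<dots> \<le> 2 * (norm (p - y))\<^sup>2 + 2 * (\<eta> * norm (v - grad f y))\<^sup>2"
    using sum_squares_bound[of "norm (p - y)" "\<eta> * norm (v - grad f y)"]
    by (simp add: power2_sum)
  finally show ?thesis
    by (simp add: p_def power_mult_distrib)
qed

text \<open>The weights \<open>1 / (3 L)\<close> and \<open>3 L / 4\<close> in Young's inequality leave exactly
  \<open>1 / \<eta> - L - L \<gamma> / 2\<close> in front of the squared step length.\<close>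

lemma one_step:
  fixes v :: 'a
  assumes y: "y \<in> edom \<psi>" and \<gamma>: "0 \<le> \<gamma>" "\<gamma> \<le> 1"
  defines "p \<equiv> prox \<eta> \<psi> (y - \<eta> *\<^sub>R v)"
  defines "x' \<equiv> (1 - \<gamma>) *\<^sub>R y + \<gamma> *\<^sub>R p"
  shows "f x' + real_of_ereal (\<psi> x') + \<gamma> * (L * \<eta>\<^sup>2 / 8 * (norm (grad_map \<eta> f \<psi> y))\<^sup>2)
      + \<gamma> * ((1 / \<eta> - L - L * \<gamma> / 2) * (norm (p - y))\<^sup>2)
    \<le> f y + real_of_ereal (\<psi> y) + \<gamma> * ((1 / (3 * L) + L * \<eta>\<^sup>2 / 4) * (norm (v - grad f y))\<^sup>2)"
proof -
  define D where "D = (norm (p - y))\<^sup>2"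
  define E where "E = (norm (v - grad f y))\<^sup>2"
  define G where "G = (norm (grad_map \<eta> f \<psi> y))\<^sup>2"
  have pd: "p \<in> edom \<psi>"
    unfolding p_def by (rule prox_edom)
  have xd: "x' \<in> edom \<psi>"
    unfolding x'_def p_def by (rule prox_step_edom[OF y \<gamma>])
  have xy: "x' - y = \<gamma> *\<^sub>R (p - y)"
    by (simp add: x'_def algebra_simps)
  have 1: "f x' \<le> f y + \<gamma> * inner (grad f y) (p - y) + L / 2 * \<gamma>\<^sup>2 * D"
    using f_descent[OF y xd] \<gamma> by (simp add: xy D_def power_mult_distrib)
  have 2: "real_of_ereal (\<psi> x') \<le> (1 - \<gamma>) * real_of_ereal (\<psi> y) + \<gamma> * real_of_ereal (\<psi> p)"
    unfolding x'_def by (rule edom_convex_comb(2)[OF proper convex y pd \<gamma>])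
  \<comment> \<open>Optimality of \<open>p\<close> tested at \<open>y\<close> itself. It yields the
    full \<open>D / \<eta>\<close>, twice what a comparison of objective values would give.\<close>
  have "inner (p - (y - \<eta> *\<^sub>R v)) (y - p) = - D - \<eta> * inner v (p - y)"
    by (simp add: D_def power2_norm_eq_inner inner_diff_left inner_diff_right inner_add_left
        inner_commute algebra_simps)
  with prox_variational[OF y, of "y - \<eta> *\<^sub>R v"]
  have "\<eta> * real_of_ereal (\<psi> p) \<le> \<eta> * real_of_ereal (\<psi> y) - D - \<eta> * inner v (p - y)"
    by (simp add: p_def)
  then have 3: "real_of_ereal (\<psi> p) \<le> real_of_ereal (\<psi> y) - D / \<eta> - inner v (p - y)"
    using eta by (simp add: field_simps)
  have 4: "inner (grad f y) (p - y) - inner v (p - y) \<le> E / (3 * L) + 3 * L / 4 * D"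
  proof -
    have "inner (grad f y) (p - y) - inner v (p - y) = inner (grad f y - v) (p - y)"
      by (simp add: inner_diff_left)
    also have "\<dots> \<le> norm (v - grad f y) * norm (p - y)"
      using norm_cauchy_schwarz[of "grad f y - v" "p - y"] by (simp add: norm_minus_commute)
    also have "\<dots> \<le> E / (3 * L) + 3 * L / 4 * D"
    proof -
      have "0 \<le> (2 * norm (v - grad f y) - 3 * L * norm (p - y))\<^sup>2" by simp
      then have "12 * L * (norm (v - grad f y) * norm (p - y)) \<le> 4 * E + 9 * L\<^sup>2 * D"
        by (simp add: power2_diff D_def E_def power_mult_distrib algebra_simps)
      then show ?thesis
        using L by (simp add: field_simps power2_eq_square)
    qed
    finally show ?thesis .
  qed
  \<comment> \<open>Bringing in the gradient mapping costs another \<open>L / 4 * D\<close>. With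
    \<open>3 * L / 4 * D\<close> from Young's inequality this makes \<open>L * D\<close>, which
    turns \<open>D / \<eta>\<close> into \<open>(1 / \<eta> - L) * D\<close>.\<close>
  have 5: "L * \<eta>\<^sup>2 / 8 * G \<le> L / 4 * D + L * \<eta>\<^sup>2 / 4 * E"
  proof -
    have "\<eta>\<^sup>2 * G \<le> 2 * D + 2 * \<eta>\<^sup>2 * E"
      using grad_map_le[of y v] by (simp add: power_mult_distrib G_def D_def E_def p_def)
    then have "L / 8 * (\<eta>\<^sup>2 * G) \<le> L / 8 * (2 * D + 2 * \<eta>\<^sup>2 * E)"
      using L by (intro mult_left_mono) auto
    then show ?thesis by (simp add: algebra_simps)
  qed
  have "inner (grad f y) (p - y) + real_of_ereal (\<psi> p) + L * \<eta>\<^sup>2 / 8 * G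
      \<le> real_of_ereal (\<psi> y) + (1 / (3 * L) + L * \<eta>\<^sup>2 / 4) * E - (1 / \<eta> - L) * D"
    using 3 4 5 by (simp add: algebra_simps)
  then have "\<gamma> * (inner (grad f y) (p - y) + real_of_ereal (\<psi> p) + L * \<eta>\<^sup>2 / 8 * G)
      \<le> \<gamma> * (real_of_ereal (\<psi> y) + (1 / (3 * L) + L * \<eta>\<^sup>2 / 4) * E - (1 / \<eta> - L) * D)"
    using \<gamma> by (intro mult_left_mono)
  with 1 2 show ?thesis
    unfolding D_def[symmetric] E_def[symmetric] G_def[symmetric]
    by (simp add: algebra_simps power2_eq_square)
qed

end

section \<open>The step weights\<close>

text \<open>The total weight with which an error present at time \<open>t\<close> enters the
  \<open>\<gamma>\<close>-weighted sum up to time \<open>m\<close> when errors shrink by the factor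
  \<open>q\<close> per step.\<close>

definition disc_tail :: "real \<Rightarrow> (nat \<Rightarrow> real) \<Rightarrow> nat \<Rightarrow> nat \<Rightarrow> real" where
  "disc_tail q \<gamma> m t = (\<Sum>j=t..m. q ^ (j - t) * \<gamma> j)"

lemma disc_tail_last: "disc_tail q \<gamma> m m = \<gamma> m"
  by (simp add: disc_tail_def)

lemma disc_tail_Suc:
  assumes "t < m"
  shows "disc_tail q \<gamma> m t = \<gamma> t + q * disc_tail q \<gamma> m (Suc t)"
proof -
  have "disc_tail q \<gamma> m t = \<gamma> t + (\<Sum>j=Suc t..m. q ^ (j - t) * \<gamma> j)"
    unfolding disc_tail_def using assms by (subst sum.atLeast_Suc_atMost) auto
  also have "(\<Sum>j=Suc t..m. q ^ (j - t) * \<gamma> j) = q * disc_tail q \<gamma> m (Suc t)"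
    unfolding disc_tail_def sum_distrib_left
    by (rule sum.cong) (auto simp: Suc_diff_le[symmetric] simp flip: power_Suc mult.assoc)
  finally show ?thesis .
qed

text \<open>Identifies the bracket in the step-size rule, so that the rule becomes the recursion of
  \<open>step_weights\<close>.\<close>

lemma disc_tail_shift:
  "(\<Sum>j=t+1..m. \<beta> ^ (2 * (j - t)) * \<gamma> j) = \<beta>\<^sup>2 * disc_tail (\<beta>\<^sup>2) \<gamma> m (Suc t)"
  unfolding disc_tail_def sum_distrib_left
proof (rule sum.cong)
  fix j assume "j \<in> {Suc t..m}"
  then have "j - t = Suc (j - Suc t)" by auto
  then show "\<beta> ^ (2 * (j - t)) * \<gamma> j = \<beta>\<^sup>2 * ((\<beta>\<^sup>2) ^ (j - Suc t) * \<gamma> j)"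
    by (simp only: power_mult power_Suc mult.assoc)
qed simp

text \<open>The step-size rule in scale-free form, with \<open>g\<close> for \<delta>/L,
  \<open>c\<close> for 1 + L^2 \<eta>^2 and \<open>q\<close> for \<beta>^2; \<open>c \<le> 2\<close>
  reflects \<eta> L < 1. It runs backwards from \<open>m\<close>, each weight depending on the tail
  after it.\<close>

locale step_weights =
  fixes \<gamma> :: "nat \<Rightarrow> real" and m :: nat and c g q :: real
  assumes c: "0 \<le> c" "c \<le> 2" and g: "0 < g" "g \<le> 1" and q: "0 < q" "q < 1"
    and last: "\<gamma> m = g"
    and rec: "\<And>t. t < m \<Longrightarrow> \<gamma> t = g / (1 + c * q * disc_tail q \<gamma> m (Suc t))"
    and pos: "\<And>t. t \<le> m \<Longrightarrow> 0 < \<gamma> t"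
begin

abbreviation "R \<equiv> disc_tail q \<gamma> m"
abbreviation "W \<equiv> (\<Sum>t\<le>m. \<gamma> t)"

lemma R_nonneg: "0 \<le> R t"
  unfolding disc_tail_def using pos q by (intro sum_nonneg) (auto intro!: mult_nonneg_nonneg less_imp_le)

lemma R_pos: "t \<le> m \<Longrightarrow> 0 < R t"
  unfolding disc_tail_def using pos q by (intro sum_pos) auto

lemma W_pos: "0 < W"
  using pos by (intro sum_pos) auto

lemma sum_R_Suc: "(\<Sum>t<m. R (Suc t)) = (\<Sum>t\<le>m. R t) - R 0"
  using sum.lessThan_Suc_shift[of R m] by (simp add: lessThan_Suc_atMost)

text \<open>Sum the relation \<open>R t = \<gamma> t + q * R (Suc t)\<close> over all steps.
  Converting total tail mass into total weight serves both the lower bound on \<open>W\<close> and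
  the accumulated noise.\<close>

lemma sum_R: "(1 - q) * (\<Sum>t\<le>m. R t) = W - q * R 0"
proof -
  have "(\<Sum>t\<le>m. R t) = (\<Sum>t<m. R t) + R m"
    by (simp flip: lessThan_Suc_atMost)
  also have "(\<Sum>t<m. R t) = (\<Sum>t<m. \<gamma> t) + q * (\<Sum>t<m. R (Suc t))"
    by (simp add: disc_tail_Suc sum.distrib sum_distrib_left)
  also note sum_R_Suc
  finally have "(\<Sum>t\<le>m. R t) = (\<Sum>t<m. \<gamma> t) + q * ((\<Sum>t\<le>m. R t) - R 0) + R m" .
  moreover have "W = (\<Sum>t<m. \<gamma> t) + R m"
    by (simp add: disc_tail_last flip: lessThan_Suc_atMost)
  ultimately show ?thesis by algebra
qed

lemma sum_R_le: "(1 - q) * (\<Sum>t\<le>m. R t) \<le> W"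
  using sum_R R_nonneg[of 0] q by simp

lemma weight_mult: "t < m \<Longrightarrow> \<gamma> t * (1 + c * q * R (Suc t)) = g"
proof -
  assume "t < m"
  moreover have "0 \<le> c * q * R (Suc t)"
    using c q R_nonneg by simp
  ultimately show ?thesis
    using rec[of t] by (simp add: field_simps)
qed

text \<open>Arithmetic versus harmonic mean, in the form \<open>\<Sum>\<gamma> \<cdot> \<Sum>(g / \<gamma>) \<ge> g (m + 1)\<^sup>2\<close>; this needs no
  monotonicity of \<open>\<gamma>\<close>, which can fail for small \<open>m\<close>.\<close>

lemma AM_HM_weights: "g * (real (m + 1))\<^sup>2 \<le> W * (real (m + 1) + c * q / (1 - q) * W)"
proof -
  define y where "y t = g / \<gamma> t" for t
  have y: "y t * \<gamma> t = g" "0 < y t" if "t \<le> m" for t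
    using pos[OF that] g by (auto simp: y_def)
  \<comment> \<open>\<open>y t\<close> is the denominator of the step-size rule divided by
    \<open>L\<close>, hence affine in the next tail; at \<open>t = m\<close> it is 1.\<close>
  have ysum: "(\<Sum>t\<le>m. y t) \<le> real (m + 1) + c * q / (1 - q) * W"
  proof -
    have "(\<Sum>t\<le>m. y t) = (\<Sum>t<m. y t) + y m"
      by (simp flip: lessThan_Suc_atMost)
    also have "(\<Sum>t<m. y t) = (\<Sum>t<m. 1 + c * q * R (Suc t))"
    proof (rule sum.cong)
      fix t assume "t \<in> {..<m}"
      then show "y t = 1 + c * q * R (Suc t)"
        using weight_mult[of t] pos[of t] by (simp add: y_def field_simps)
    qed simp
    also have "\<dots> = real m + c * q * (\<Sum>t<m. R (Suc t))"
      by (simp add: sum.distrib sum_distrib_left)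
    also have "y m = 1"
      using last g by (simp add: y_def)
    also note sum_R_Suc
    finally have "(\<Sum>t\<le>m. y t) = real (m + 1) + c * q * ((\<Sum>t\<le>m. R t) - R 0)" by linarith
    moreover have "(\<Sum>t\<le>m. R t) \<le> W / (1 - q)"
      using sum_R_le q by (simp add: field_simps)
    then have "(\<Sum>t\<le>m. R t) - R 0 \<le> W / (1 - q)"
      using R_nonneg[of 0] by linarith
    then have "c * q * ((\<Sum>t\<le>m. R t) - R 0) \<le> c * q * (W / (1 - q))"
      using c q by (intro mult_left_mono) auto
    moreover have "c * q * (W / (1 - q)) = c * q / (1 - q) * W" by simp
    ultimately show ?thesis by linarith
  qed
  have "(\<Sum>t\<le>m. sqrt (\<gamma> t) * sqrt (y t))\<^sup>2 \<le> (\<Sum>t\<le>m. (sqrt (\<gamma> t))\<^sup>2) * (\<Sum>t\<le>m. (sqrt (y t))\<^sup>2)"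
    by (rule Cauchy_Schwarz_ineq_sum)
  also have "(\<Sum>t\<le>m. sqrt (\<gamma> t) * sqrt (y t)) = (\<Sum>t\<le>m. sqrt g)"
  proof (rule sum.cong)
    fix t assume "t \<in> {..m}"
    then have "g = \<gamma> t * y t" using y(1)[of t] by (simp add: mult.commute)
    then show "sqrt (\<gamma> t) * sqrt (y t) = sqrt g" by (simp add: real_sqrt_mult)
  qed simp
  also have "(\<Sum>t\<le>m. (sqrt (\<gamma> t))\<^sup>2) = W"
    using pos by (intro sum.cong) (auto simp: less_imp_le)
  also have "(\<Sum>t\<le>m. (sqrt (y t))\<^sup>2) = (\<Sum>t\<le>m. y t)"
    using y by (intro sum.cong) (auto simp: less_imp_le)
  finally have "g * (real (m + 1))\<^sup>2 \<le> W * (\<Sum>t\<le>m. y t)"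
    using g by (simp add: power_mult_distrib mult.commute)
  also have "\<dots> \<le> W * (real (m + 1) + c * q / (1 - q) * W)"
    using ysum W_pos by (intro mult_left_mono) auto
  finally show ?thesis .
qed

text \<open>The map \<open>S \<mapsto> g / (1 + c S) + S\<close> is convex, so at the maximal tail \<open>B\<close> it is bounded by its
  values at the endpoints of \<open>[0, q B]\<close>.\<close>

lemma R_0_le: "(1 - q) * real (m + 1) * R 0 \<le> 9 / 8 * W"
proof -
  define B where "B = Max (R ` {..m})"
  have B: "R t \<le> B" if "t \<le> m" for t
    unfolding B_def using that by (intro Max_ge) auto
  have "B \<in> R ` {..m}"
    unfolding B_def by (intro Max_in) auto
  then obtain s where s: "s \<le> m" "B = R s" by auto
  have B0: "0 \<le> B" using s R_nonneg by simp
  define u where "u = 1 + c * q * B"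
  have u: "1 \<le> u" using c q B0 by (simp add: u_def)
  have low: "g / u \<le> \<gamma> t" if "t \<le> m" for t
  proof (cases "t = m")
    case True
    have "g / u \<le> g / 1" using g u by (intro divide_left_mono) auto
    then show ?thesis using last True by simp
  next
    case False
    then have t: "t < m" using that by simp
    have "c * q * R (Suc t) \<le> c * q * B"
      using t c q B[of "Suc t"] by (intro mult_left_mono) auto
    moreover have "0 \<le> c * q * R (Suc t)"
      using c q R_nonneg by simp
    ultimately show ?thesis
      unfolding rec[OF t] u_def using g by (intro divide_left_mono) auto
  qed
  have mean: "real (m + 1) * (g / u) \<le> W"
    using sum_bounded_below[of "{..m}" "g / u" \<gamma>] low by simp
  have "(1 - q) * B \<le> 9 / 8 * (g / u)"
  proof (cases "B \<le> g")
    case True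
    have "c * q * B \<le> 2 * q * 1"
      using True c g q B0 by (intro mult_mono) auto
    then have "(1 - q) * u \<le> (1 - q) * (1 + 2 * q)"
      unfolding u_def using q by (intro mult_left_mono) auto
    \<comment> \<open>This is where 9/8 comes from: it is the maximum of
      \<open>(1 - q) * (1 + 2 * q)\<close>, attained at q = 1/4.\<close>
    also have "\<dots> = 9 / 8 - 2 * (q - 1 / 4)\<^sup>2"
      by (simp add: power2_eq_square algebra_simps)
    also have "\<dots> \<le> 9 / 8" by simp
    finally have "B * ((1 - q) * u) \<le> g * (9 / 8)"
      using True B0 u q by (intro mult_mono) auto
    then show ?thesis
      using u by (simp add: field_simps)
  next
    case False
    then have "s \<noteq> m" using s last disc_tail_last by auto
    then have sm: "s < m" using s by simp
    define S where "S = q * R (Suc s)"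
    have S: "0 \<le> S" "S \<le> q * B"
      using q R_nonneg B[of "Suc s"] sm by (auto simp: S_def intro!: mult_left_mono)
    have cS: "0 < 1 + c * S" using c S by (simp add: add_pos_nonneg)
    have "B = g / (1 + c * S) + S"
      using disc_tail_Suc[OF sm, of q \<gamma>] s rec[OF sm] by (simp add: S_def mult.assoc)
    then have eq: "B * (1 + c * S) = g + S * (1 + c * S)"
      using cS by (simp add: field_simps)
    have "g < B" using False by simp
    have "S \<noteq> 0" using eq \<open>g < B\<close> by auto
    then have S0: "0 < S" using S by simp
    have "S * (c * (B - S) - 1) = g - B"
      using eq by (simp add: algebra_simps)
    then have "S * (c * (B - S) - 1) < 0"
      using \<open>g < B\<close> by simp
    then have "c * (B - S) < 1"
      using S0 by (simp add: mult_less_0_iff)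
    then have "c * (B - q * B) - 1 \<le> 0"
      using S c by (smt (verit) mult_left_mono)
    then have *: "(q * B - S) * (c * (B - q * B) - 1) \<le> 0"
      using S by (intro mult_nonneg_nonpos) auto
    have "c * S * (q * B - S) \<ge> 0"
      using c S by simp
    \<comment> \<open>The function \<open>(B - y) * (1 + c * y)\<close> of \<open>y\<close> equals
      \<open>g\<close> at \<open>y = S\<close>; the two sign facts show that moving from
      \<open>S\<close> to \<open>q * B\<close> does not increase it.\<close>
    have "(B - q * B) * (1 + c * q * B) \<le> g"
    proof -
      have "(B - q * B) * (1 + c * q * B) - g = (B - q * B) * (1 + c * (q * B)) - (B - S) * (1 + c * S)"
        using eq by (simp add: algebra_simps)
      also have "\<dots> = (q * B - S) * (c * (B - q * B) - 1) - c * S * (q * B - S)"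
        by (simp add: algebra_simps)
      also have "\<dots> \<le> 0" using * \<open>c * S * (q * B - S) \<ge> 0\<close> by linarith
      finally show ?thesis by simp
    qed
    then have "(1 - q) * B * u \<le> g"
      by (simp add: u_def algebra_simps)
    then have "(1 - q) * B \<le> g / u"
      using u by (simp add: field_simps)
    also have "\<dots> \<le> 9 / 8 * (g / u)"
      using u g by (simp add: field_simps)
    finally show ?thesis .
  qed
  then have "real (m + 1) * ((1 - q) * B) \<le> real (m + 1) * (9 / 8 * (g / u))"
    by (rule mult_left_mono) simp
  also have "\<dots> = 9 / 8 * (real (m + 1) * (g / u))"
    by (simp only: mult.left_commute)
  also have "\<dots> \<le> 9 / 8 * W"
    using mean by (rule mult_left_mono) simp
  finally have "real (m + 1) * ((1 - q) * B) \<le> 9 / 8 * W" .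
  moreover have "real (m + 1) * ((1 - q) * R 0) \<le> real (m + 1) * ((1 - q) * B)"
    using B[of 0] q by (intro mult_left_mono) auto
  ultimately show ?thesis
    by (simp add: algebra_simps)
qed

text \<open>Write \<open>\<gamma> t\<close> as \<open>R t - q * R (Suc t)\<close> and shift the
  index. The initial error keeps the weight \<open>R 0\<close>, and each defect
  \<open>E (Suc t) - q * E t\<close> gets the nonnegative weight \<open>R (Suc t)\<close>.\<close>

lemma sum_weighted_recursion:
  fixes E Y :: "nat \<Rightarrow> real"
  assumes "\<And>t. t < m \<Longrightarrow> E (Suc t) \<le> q * E t + Y t"
  shows "(\<Sum>t\<le>m. \<gamma> t * E t) \<le> R 0 * E 0 + (\<Sum>t<m. R (Suc t) * Y t)"
proof -
  have "(\<Sum>t\<le>m. \<gamma> t * E t) = (\<Sum>t<m. \<gamma> t * E t) + R m * E m"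
    by (simp add: disc_tail_last flip: lessThan_Suc_atMost)
  also have "(\<Sum>t<m. \<gamma> t * E t) = (\<Sum>t<m. R t * E t) - (\<Sum>t<m. R (Suc t) * (q * E t))"
    by (simp add: disc_tail_Suc algebra_simps flip: sum_subtractf)
  also have "(\<Sum>t<m. R t * E t) + R m * E m = R 0 * E 0 + (\<Sum>t<m. R (Suc t) * E (Suc t))"
    using sum.lessThan_Suc_shift[of "\<lambda>t. R t * E t" m] by simp
  then have "(\<Sum>t<m. R t * E t) - (\<Sum>t<m. R (Suc t) * (q * E t)) + R m * E m
      = R 0 * E 0 + (\<Sum>t<m. R (Suc t) * (E (Suc t) - q * E t))"
    by (simp add: sum_subtractf right_diff_distrib)
  also have "(\<Sum>t<m. R (Suc t) * (E (Suc t) - q * E t)) \<le> (\<Sum>t<m. R (Suc t) * Y t)"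
    using assms by (intro sum_mono mult_left_mono R_nonneg) (simp add: algebra_simps)
  finally show ?thesis by simp
qed

end

section \<open>Real inequalities behind the rate and the counts\<close>

lemma mean_weight_lower_bound:
  fixes s a L \<delta> :: real
  assumes pos: "0 < s" "0 < a" "0 < L" "0 < \<delta>" and le: "\<delta> \<le> L * s + L * s\<^sup>2 / a"
  shows "\<delta> / (sqrt 2 * (L + sqrt (\<delta> * L / a))) \<le> s"
proof (rule ccontr)
  assume *: "\<not> ?thesis"
  define Q where "Q = sqrt (\<delta> * L / a)"
  have Q0: "0 \<le> Q" and Q2: "Q\<^sup>2 = \<delta> * L / a"
    using pos by (auto simp: Q_def)
  \<comment> \<open>Were \<open>s\<close> below the claimed bound, the two terms on the right of
    \<open>le\<close> would be at most \<open>\<delta>\<close> times \<open>r / sqrt 2\<close> and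
    \<open>\<delta>\<close> times \<open>(1 - r)\<^sup>2 / 2\<close>. These factors sum to at most
    1/2 + r/4, which is below 1.\<close>
  define r where "r = L / (L + Q)"
  have LQ: "0 < L + Q" using Q0 pos by simp
  have r: "0 \<le> r" "r \<le> 1" using Q0 pos by (auto simp: r_def)
  have s: "s < \<delta> / (sqrt 2 * (L + Q))" using * by (simp add: Q_def)
  have "L * s \<le> L * (\<delta> / (sqrt 2 * (L + Q)))"
    using s pos by (intro mult_left_mono) auto
  also have "\<dots> = \<delta> * (r / sqrt 2)"
    by (simp add: r_def mult.commute)
  finally have 1: "L * s \<le> \<delta> * (r / sqrt 2)" .
  have "s\<^sup>2 \<le> (\<delta> / (sqrt 2 * (L + Q)))\<^sup>2"
    using s pos by (intro power_mono) auto
  also have "\<dots> = \<delta>\<^sup>2 / (2 * (L + Q)\<^sup>2)"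
    by (simp add: power_divide power_mult_distrib)
  finally have "L / a * s\<^sup>2 \<le> L / a * (\<delta>\<^sup>2 / (2 * (L + Q)\<^sup>2))"
    using pos by (intro mult_left_mono) auto
  also have "\<dots> = \<delta> * (Q\<^sup>2 / (2 * (L + Q)\<^sup>2))"
    unfolding Q2 by (simp add: power2_eq_square)
  also have "\<dots> = \<delta> * ((1 - r)\<^sup>2 / 2)"
    using LQ by (simp add: r_def diff_divide_eq_iff power_divide)
  finally have 2: "L * s\<^sup>2 / a \<le> \<delta> * ((1 - r)\<^sup>2 / 2)" by simp
  have "r / sqrt 2 \<le> r * (3 / 4)"
    using r(1) real_le_rsqrt[of "4/3" 2] by (simp add: field_simps power2_eq_square mult_left_mono)
  moreover have "(1 - r)\<^sup>2 \<le> 1 - r"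
    using r by (simp add: power2_eq_square mult_left_le)
  ultimately have "r / sqrt 2 + (1 - r)\<^sup>2 / 2 < 1"
    using r by linarith
  then have "\<delta> * (r / sqrt 2 + (1 - r)\<^sup>2 / 2) < \<delta>"
    using pos by simp
  then have "\<delta> * (r / sqrt 2) + \<delta> * ((1 - r)\<^sup>2 / 2) < \<delta>"
    by (simp only: distrib_left)
  with 1 2 le show False by linarith
qed

text \<open>With \<open>n\<close> the cube root of \<open>N\<close>, the batch size makes
  \<open>B * N\<close> the square of \<open>c1 * n\<^sup>2\<close>, and both terms decay like the
  inverse square of \<open>n\<close>. The leading \<open>L\<close> in the bracket is enlarged to
  \<open>L * n\<close>, using \<open>1 \<le> n\<close>.\<close>

lemma complexity_rate:
  fixes L \<eta> \<delta> \<Delta> \<sigma> c1 N B :: real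
  assumes L: "0 < L" and \<eta>: "0 < \<eta>" and \<delta>: "0 < \<delta>" and \<Delta>: "0 \<le> \<Delta>" and c1: "0 < c1" and N: "1 \<le> N"
    and B: "B = c1\<^sup>2 * N powr (1/3)"
  shows "8 * sqrt 2 * (L + sqrt (\<delta> * L) * (B * N) powr (1/4)) / (L * \<eta>\<^sup>2 * \<delta> * N) * \<Delta>
      + 8 * \<sigma>\<^sup>2 / (L\<^sup>2 * \<eta>\<^sup>2 * sqrt (B * N))
    \<le> 8 / (L\<^sup>2 * \<eta>\<^sup>2) * (sqrt 2 * L * (L + sqrt (c1 * L * \<delta>)) / \<delta> * \<Delta> + \<sigma>\<^sup>2 / c1) / N powr (2/3)"
proof -
  define n where "n = N powr (1/3)"
  have n1: "1 \<le> n" unfolding n_def using N by (rule ge_one_powr_ge_zero) simp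
  have n2: "N powr (2/3) = n\<^sup>2"
    unfolding n_def using N by (simp add: powr_powr flip: powr_realpow)
  have n3: "N = n ^ 3"
    unfolding n_def using N by (simp add: powr_powr flip: powr_realpow)
  have BN: "B * N = (c1 * n\<^sup>2)\<^sup>2"
    unfolding B n_def[symmetric] by (subst n3) (simp add: power2_eq_square power3_eq_cube)
  have sqrtBN: "sqrt (B * N) = c1 * n\<^sup>2"
    unfolding BN using c1 by simp
  have "(B * N) powr (1/4) = sqrt (sqrt (B * N))"
  proof -
    have "0 \<le> B * N" unfolding BN by simp
    then have "sqrt (sqrt (B * N)) = ((B * N) powr (1/2)) powr (1/2)"
      by (simp add: powr_half_sqrt)
    then show ?thesis by (simp add: powr_powr)
  qed
  also have "\<dots> = sqrt c1 * n"
    unfolding sqrtBN using n1 by (simp add: real_sqrt_mult)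
  finally have quart: "(B * N) powr (1/4) = sqrt c1 * n" .
  have "L + sqrt (\<delta> * L) * (sqrt c1 * n) \<le> (L + sqrt (c1 * L * \<delta>)) * n"
    using L n1 by (simp add: real_sqrt_mult algebra_simps)
  then have "8 * sqrt 2 * \<Delta> / (L * \<eta>\<^sup>2 * \<delta> * N) * (L + sqrt (\<delta> * L) * (sqrt c1 * n))
      \<le> 8 * sqrt 2 * \<Delta> / (L * \<eta>\<^sup>2 * \<delta> * N) * ((L + sqrt (c1 * L * \<delta>)) * n)"
    using L \<eta> \<delta> \<Delta> N by (intro mult_left_mono) auto
  also have "\<dots> = 8 / (L\<^sup>2 * \<eta>\<^sup>2) * (sqrt 2 * L * (L + sqrt (c1 * L * \<delta>)) / \<delta> * \<Delta>) / n\<^sup>2"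
    unfolding n3 using L \<eta> \<delta> n1 by (simp add: power2_eq_square power3_eq_cube ac_simps)
  finally have "8 * sqrt 2 * (L + sqrt (\<delta> * L) * (B * N) powr (1/4)) / (L * \<eta>\<^sup>2 * \<delta> * N) * \<Delta>
      \<le> 8 / (L\<^sup>2 * \<eta>\<^sup>2) * (sqrt 2 * L * (L + sqrt (c1 * L * \<delta>)) / \<delta> * \<Delta>) / n\<^sup>2"
    unfolding quart by (simp add: ac_simps)
  moreover have "8 * \<sigma>\<^sup>2 / (L\<^sup>2 * \<eta>\<^sup>2 * sqrt (B * N)) = 8 / (L\<^sup>2 * \<eta>\<^sup>2) * (\<sigma>\<^sup>2 / c1) / n\<^sup>2"
    unfolding sqrtBN by simp
  ultimately show ?thesis
    unfolding n2 by (simp only: distrib_left add_divide_distrib)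
qed

lemma accuracy_of_iteration_count:
  fixes D N \<epsilon> :: real
  assumes D: "0 \<le> D" and \<epsilon>: "0 < \<epsilon>" and N: "0 < N" and le: "D powr (3/2) / \<epsilon> ^ 3 \<le> N"
  shows "D / N powr (2/3) \<le> \<epsilon>\<^sup>2"
proof -
  have "(D powr (3/2) / \<epsilon> ^ 3) powr (2/3) \<le> N powr (2/3)"
    using le \<epsilon> by (intro powr_mono2) auto
  moreover have "(D powr (3/2) / \<epsilon> ^ 3) powr (2/3) = D / \<epsilon>\<^sup>2"
  proof -
    have "(\<epsilon> ^ 3) powr (2/3) = (\<epsilon> powr 3) powr (2/3)"
      using \<epsilon> by simp
    also have "\<dots> = \<epsilon> powr 2"
      by (subst powr_powr) simp
    finally have "(\<epsilon> ^ 3) powr (2/3) = \<epsilon>\<^sup>2"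
      using \<epsilon> by simp
    then show ?thesis
      using D \<epsilon> by (simp add: powr_divide powr_powr)
  qed
  ultimately have "D / \<epsilon>\<^sup>2 \<le> N powr (2/3)" by simp
  then show ?thesis
    using \<epsilon> N by (simp add: field_simps)
qed

text \<open>Expresses the batch size \<open>c1\<^sup>2 * N powr (1/3)\<close> through the accuracy,
  for the gradient count.\<close>

lemma iteration_count_cube_root:
  fixes D N \<epsilon> :: real
  assumes D: "0 \<le> D" and \<epsilon>: "0 < \<epsilon>" and eq: "N = D powr (3/2) / \<epsilon> ^ 3"
  shows "N powr (1/3) = D powr (1/2) / \<epsilon>"
proof -
  have "(\<epsilon> ^ 3) powr (1/3) = (\<epsilon> powr 3) powr (1/3)"
    using \<epsilon> by simp
  also have "\<dots> = \<epsilon>"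
    using \<epsilon> by (subst powr_powr) simp
  finally have "(\<epsilon> ^ 3) powr (1/3) = \<epsilon>" .
  then show ?thesis
    unfolding eq using D \<epsilon> by (simp add: powr_divide powr_powr)
qed

section \<open>Second moments and random indices\<close>

text \<open>For a random point with finitely many values, measurability is a finite case split;
  simple functions converging to \<open>Y\<close> and continuity in the second argument extend it.
  It is meant for sampled gradients evaluated at random iterates.\<close>

lemma borel_measurable_Caratheodory:
  fixes h :: "'s \<Rightarrow> 'a::{metric_space,second_countable_topology} \<Rightarrow> 'b::metric_space"
  assumes meas: "\<And>y. (\<lambda>\<xi>. h \<xi> y) \<in> borel_measurable P"
    and cont: "\<And>\<xi>. \<xi> \<in> space P \<Longrightarrow> continuous_on UNIV (h \<xi>)"
    and X: "X \<in> measurable N P" and Y: "Y \<in> borel_measurable N"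
  shows "(\<lambda>\<omega>. h (X \<omega>) (Y \<omega>)) \<in> borel_measurable N"
proof -
  obtain F where F: "\<And>i. simple_function N (F i)" and lim: "\<And>\<omega>. \<omega> \<in> space N \<Longrightarrow> (\<lambda>i. F i \<omega>) \<longlonglongrightarrow> Y \<omega>"
    using borel_measurable_implies_sequence_metric[OF Y, of undefined] by metis
  show ?thesis
  proof (rule borel_measurable_LIMSEQ_metric)
    fix i
    have "F i \<in> measurable N (count_space (F i ` space N))"
      using measurable_simple_function[OF F[of i]] unfolding measurable_def by auto
    then show "(\<lambda>\<omega>. h (X \<omega>) (F i \<omega>)) \<in> borel_measurable N"
      using measurable_compose_countable'[where f="\<lambda>y \<omega>. h (X \<omega>) y" and g="F i" and I="F i ` space N"]
        measurable_compose[OF X meas] simple_functionD(1)[OF F[of i]]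
      by (simp add: countable_finite)
  next
    fix \<omega> assume \<omega>: "\<omega> \<in> space N"
    then have "X \<omega> \<in> space P"
      using X by (rule measurable_space[rotated])
    then show "(\<lambda>i. h (X \<omega>) (F i \<omega>)) \<longlonglongrightarrow> h (X \<omega>) (Y \<omega>)"
      by (intro continuous_on_tendsto_compose[OF cont lim[OF \<omega>]]) simp_all
  qed
qed

context prob_space
begin

lemma centered_second_moment:
  fixes Z :: "'a \<Rightarrow> 'b::euclidean_space"
  assumes Z: "integrable M Z" and mean: "(LINT \<xi>|M. Z \<xi>) = 0"
    and Z2: "integrable M (\<lambda>\<xi>. (norm (Z \<xi>))\<^sup>2)"
  shows "integrable M (\<lambda>\<xi>. (norm (A + Z \<xi>))\<^sup>2)"
    and "(LINT \<xi>|M. (norm (A + Z \<xi>))\<^sup>2) = (norm A)\<^sup>2 + (LINT \<xi>|M. (norm (Z \<xi>))\<^sup>2)"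
proof -
  have eq: "(\<lambda>\<xi>. (norm (A + Z \<xi>))\<^sup>2) = (\<lambda>\<xi>. (norm A)\<^sup>2 + 2 * inner A (Z \<xi>) + (norm (Z \<xi>))\<^sup>2)"
    by (simp add: power2_norm_eq_inner inner_add_left inner_add_right inner_commute algebra_simps)
  show "integrable M (\<lambda>\<xi>. (norm (A + Z \<xi>))\<^sup>2)"
    unfolding eq using Z Z2 by (intro Bochner_Integration.integrable_add integrable_mult_right
        integrable_inner_right integrable_const)
  show "(LINT \<xi>|M. (norm (A + Z \<xi>))\<^sup>2) = (norm A)\<^sup>2 + (LINT \<xi>|M. (norm (Z \<xi>))\<^sup>2)"
    unfolding eq using Z Z2 by (simp add: mean prob_space)
qed

text \<open>Phrased with the nonnegative integral so that it applies inside an outer integral whose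
  finiteness is not yet known. The cross term vanishes because \<open>Z\<close> is centered.\<close>

lemma centered_nn_second_moment_le:
  fixes Z :: "'a \<Rightarrow> 'b::euclidean_space"
  assumes "integrable M Z" "(LINT \<xi>|M. Z \<xi>) = 0" "integrable M (\<lambda>\<xi>. (norm (Z \<xi>))\<^sup>2)"
    and le: "(LINT \<xi>|M. (norm (Z \<xi>))\<^sup>2) \<le> K"
  shows "(\<integral>\<^sup>+\<xi>. ennreal ((norm (A + r *\<^sub>R Z \<xi>))\<^sup>2) \<partial>M) \<le> ennreal ((norm A)\<^sup>2 + r\<^sup>2 * K)"
proof -
  have "integrable M (\<lambda>\<xi>. r *\<^sub>R Z \<xi>)" "(LINT \<xi>|M. r *\<^sub>R Z \<xi>) = 0"
    "integrable M (\<lambda>\<xi>. (norm (r *\<^sub>R Z \<xi>))\<^sup>2)"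
    using assms by (simp_all add: power_mult_distrib)
  note * = centered_second_moment[OF this, of A]
  have "(\<integral>\<^sup>+\<xi>. ennreal ((norm (A + r *\<^sub>R Z \<xi>))\<^sup>2) \<partial>M) = ennreal ((norm A)\<^sup>2 + r\<^sup>2 * (LINT \<xi>|M. (norm (Z \<xi>))\<^sup>2))"
    using * by (subst nn_integral_eq_integral) (simp_all add: power_mult_distrib)
  also have "\<dots> \<le> ennreal ((norm A)\<^sup>2 + r\<^sup>2 * K)"
    using le by (intro ennreal_leI add_left_mono mult_left_mono) auto
  finally show ?thesis .
qed

text \<open>Besides centering gradient differences, the last identity serves as the Jensen
  inequality by which the mean-square Lipschitz assumption passes to \<open>grad f\<close>.\<close>

lemma variance_le_second_moment:
  fixes Z :: "'a \<Rightarrow> 'b::euclidean_space"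
  assumes Z: "integrable M Z" and Z2: "integrable M (\<lambda>\<xi>. (norm (Z \<xi>))\<^sup>2)"
  defines "\<mu> \<equiv> (LINT \<xi>|M. Z \<xi>)"
  shows "integrable M (\<lambda>\<xi>. Z \<xi> - \<mu>)" "(LINT \<xi>|M. Z \<xi> - \<mu>) = 0"
    "integrable M (\<lambda>\<xi>. (norm (Z \<xi> - \<mu>))\<^sup>2)"
    "(LINT \<xi>|M. (norm (Z \<xi> - \<mu>))\<^sup>2) + (norm \<mu>)\<^sup>2 = (LINT \<xi>|M. (norm (Z \<xi>))\<^sup>2)"
proof -
  show 1: "integrable M (\<lambda>\<xi>. Z \<xi> - \<mu>)" "(LINT \<xi>|M. Z \<xi> - \<mu>) = 0"
    using Z by (simp_all add: \<mu>_def prob_space)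
  have eq: "(\<lambda>\<xi>. (norm (Z \<xi> - \<mu>))\<^sup>2) = (\<lambda>\<xi>. (norm (Z \<xi>))\<^sup>2 - 2 * inner \<mu> (Z \<xi>) + (norm \<mu>)\<^sup>2)"
    by (simp add: power2_norm_eq_inner inner_diff_left inner_diff_right inner_commute algebra_simps)
  show 2: "integrable M (\<lambda>\<xi>. (norm (Z \<xi> - \<mu>))\<^sup>2)"
    unfolding eq using Z Z2 by (intro Bochner_Integration.integrable_add Bochner_Integration.integrable_diff
        integrable_mult_right integrable_inner_right integrable_const)
  show "(LINT \<xi>|M. (norm (Z \<xi> - \<mu>))\<^sup>2) + (norm \<mu>)\<^sup>2 = (LINT \<xi>|M. (norm (Z \<xi>))\<^sup>2)"
    using centered_second_moment(2)[OF 1 2, of \<mu>] by simp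
qed

end

text \<open>Carries a bound between nonnegative integrals over to expectations. Integrability of
  \<open>h\<close> is a conclusion, which is what the induction along the run relies on.\<close>

lemma integral_le_of_nn_integral_le:
  fixes h g :: "'a \<Rightarrow> real"
  assumes g: "integrable M g" "\<And>\<omega>. 0 \<le> g \<omega>" and h: "h \<in> borel_measurable M" "\<And>\<omega>. 0 \<le> h \<omega>"
    and le: "(\<integral>\<^sup>+\<omega>. ennreal (h \<omega>) \<partial>M) \<le> (\<integral>\<^sup>+\<omega>. ennreal (g \<omega>) \<partial>M)"
  shows "integrable M h" "(LINT \<omega>|M. h \<omega>) \<le> (LINT \<omega>|M. g \<omega>)"
proof -
  have gn: "(\<integral>\<^sup>+\<omega>. ennreal (g \<omega>) \<partial>M) = ennreal (LINT \<omega>|M. g \<omega>)"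
    using g by (intro nn_integral_eq_integral) auto
  show i: "integrable M h"
    using h le gn by (intro integrableI_nonneg) (auto simp: le_less_trans[OF le])
  have "ennreal (LINT \<omega>|M. h \<omega>) = (\<integral>\<^sup>+\<omega>. ennreal (h \<omega>) \<partial>M)"
    using h i by (intro nn_integral_eq_integral[symmetric]) auto
  with le gn have "ennreal (LINT \<omega>|M. h \<omega>) \<le> ennreal (LINT \<omega>|M. g \<omega>)"
    by simp
  then show "(LINT \<omega>|M. h \<omega>) \<le> (LINT \<omega>|M. g \<omega>)"
    using g by (simp add: ennreal_le_iff integral_nonneg)
qed

lemma integrable_of_scaled_le:
  fixes h B :: "'a \<Rightarrow> real"
  assumes "0 < k" "h \<in> borel_measurable M" "\<And>\<omega>. 0 \<le> h \<omega>" "\<And>\<omega>. k * h \<omega> \<le> B \<omega>" "integrable M B"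
  shows "integrable M h"
proof (rule Bochner_Integration.integrable_bound)
  show "integrable M (\<lambda>\<omega>. B \<omega> / k)"
    using assms by simp
  have "norm (h \<omega>) \<le> norm (B \<omega> / k)" for \<omega>
  proof -
    have "h \<omega> \<le> B \<omega> / k"
      using assms(1) assms(4)[of \<omega>] by (simp add: field_simps)
    also have "\<dots> \<le> norm (B \<omega> / k)"
      unfolding real_norm_def by (rule abs_ge_self)
    finally show ?thesis
      using assms(3)[of \<omega>] by simp
  qed
  then show "AE \<omega> in M. norm (h \<omega>) \<le> norm (B \<omega> / k)" by simp
qed (rule assms(2))

section \<open>Independence of the random index from the samples\<close>

lemma Int_stable_vimage: "Int_stable {X -` A \<inter> \<Omega> |A. A \<in> sets N}"
proof (rule Int_stableI)
  fix a c assume "a \<in> {X -` A \<inter> \<Omega> |A. A \<in> sets N}" "c \<in> {X -` A \<inter> \<Omega> |A. A \<in> sets N}"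
  then obtain A C where "A \<in> sets N" "C \<in> sets N" "a = X -` A \<inter> \<Omega>" "c = X -` C \<inter> \<Omega>"
    by blast
  then have "a \<inter> c = X -` (A \<inter> C) \<inter> \<Omega>" "A \<inter> C \<in> sets N"
    by auto
  then show "a \<inter> c \<in> {X -` A \<inter> \<Omega> |A. A \<in> sets N}"
    by blast
qed

text \<open>Preimage families are stable under intersection, so their independence passes to the
  generated sigma-algebras. The common target \<open>K\<close> makes the pair an instance of
  \<open>indep_var\<close>.\<close>

lemma (in prob_space) indep_pair_compose:
  assumes ind: "indep_pair M N X N' Y" and f: "f \<in> measurable N K" and g: "g \<in> measurable N' K"
  shows "indep_var K (\<lambda>\<omega>. f (X \<omega>)) K (\<lambda>\<omega>. g (Y \<omega>))"
proof -
  have X: "X \<in> measurable M N" and Y: "Y \<in> measurable M N'"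
    and XY: "indep_set {X -` A \<inter> space M |A. A \<in> sets N} {Y -` B \<inter> space M |B. B \<in> sets N'}"
    using ind by (auto simp: indep_pair_def)
  have sub: "{(\<lambda>\<omega>. f' (Z \<omega>)) -` A \<inter> space M |A. A \<in> sets K} \<subseteq> {Z -` A \<inter> space M |A. A \<in> sets N''}"
    if Z: "Z \<in> measurable M N''" and f': "f' \<in> measurable N'' K" for Z f' and N'' :: "'z measure"
  proof safe
    fix A assume "A \<in> sets K"
    then have "f' -` A \<inter> space N'' \<in> sets N''"
      using f' by (rule measurable_sets[rotated])
    moreover have "(\<lambda>\<omega>. f' (Z \<omega>)) -` A \<inter> space M = Z -` (f' -` A \<inter> space N'') \<inter> space M"
      using measurable_space[OF Z] by auto
    ultimately show "\<exists>B. (\<lambda>\<omega>. f' (Z \<omega>)) -` A \<inter> space M = Z -` B \<inter> space M \<and> B \<in> sets N''"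
      by blast
  qed
  have "indep_set {(\<lambda>\<omega>. f (X \<omega>)) -` A \<inter> space M |A. A \<in> sets K}
      {(\<lambda>\<omega>. g (Y \<omega>)) -` A \<inter> space M |A. A \<in> sets K}"
    using XY unfolding indep_set_def
    by (rule indep_sets_mono_sets) (simp add: sub[OF X f] sub[OF Y g] split: bool.split)
  then have "indep_set (sigma_sets (space M) {(\<lambda>\<omega>. f (X \<omega>)) -` A \<inter> space M |A. A \<in> sets K})
      (sigma_sets (space M) {(\<lambda>\<omega>. g (Y \<omega>)) -` A \<inter> space M |A. A \<in> sets K})"
    by (intro indep_set_sigma_sets Int_stable_vimage)
  then show ?thesis
    unfolding indep_var_eq using measurable_compose[OF X f] measurable_compose[OF Y g] by simp
qed

text \<open>Expand over the events \<open>T \<omega> = t\<close>. Each indicator is independent of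
  \<open>h t (Y \<omega>)\<close>, so every summand is integrable and its expectation
  factorizes.\<close>

lemma (in prob_space) random_index_expectation:
  fixes T :: "'a \<Rightarrow> nat" and h :: "nat \<Rightarrow> 'c \<Rightarrow> real"
  assumes ind: "indep_pair M (count_space {0..m}) T N Y"
    and h: "\<And>t. t \<le> m \<Longrightarrow> h t \<in> borel_measurable N"
    and int: "\<And>t. t \<le> m \<Longrightarrow> integrable M (\<lambda>\<omega>. h t (Y \<omega>))"
  shows "integrable M (\<lambda>\<omega>. h (T \<omega>) (Y \<omega>))"
    and "(LINT \<omega>|M. h (T \<omega>) (Y \<omega>))
      = (\<Sum>t\<le>m. measure M {\<omega> \<in> space M. T \<omega> = t} * (LINT \<omega>|M. h t (Y \<omega>)))"
proof -
  have T: "T \<in> measurable M (count_space {0..m})"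
    using ind by (simp add: indep_pair_def)
  let ?I = "\<lambda>t \<omega>. indicator {t} (T \<omega>) :: real"
  have set: "{\<omega> \<in> space M. T \<omega> = t} \<in> sets M" if "t \<le> m" for t
  proof -
    have "T -` {t} \<inter> space M \<in> sets M"
      using T that by (intro measurable_sets[OF T]) auto
    moreover have "T -` {t} \<inter> space M = {\<omega> \<in> space M. T \<omega> = t}" by auto
    ultimately show ?thesis by simp
  qed
  have prod: "integrable M (\<lambda>\<omega>. ?I t \<omega> * h t (Y \<omega>))"
    "(LINT \<omega>|M. ?I t \<omega> * h t (Y \<omega>)) = measure M {\<omega> \<in> space M. T \<omega> = t} * (LINT \<omega>|M. h t (Y \<omega>))"
    if t: "t \<le> m" for t
  proof -
    have iv: "indep_var borel (?I t) borel (\<lambda>\<omega>. h t (Y \<omega>))"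
      by (rule indep_pair_compose[OF ind _ h[OF t]]) simp
    have eq: "?I t \<omega> = indicator {\<omega> \<in> space M. T \<omega> = t} \<omega>" if "\<omega> \<in> space M" for \<omega>
      using that by (simp add: indicator_def)
    have I: "integrable M (?I t)"
      using set[OF t] by (subst Bochner_Integration.integrable_cong[OF refl eq]) (auto simp: less_top[symmetric])
    have IL: "(LINT \<omega>|M. ?I t \<omega>) = measure M {\<omega> \<in> space M. T \<omega> = t}"
      using set[OF t] by (subst Bochner_Integration.integral_cong[OF refl eq]) (auto intro!: arg_cong[where f="measure M"])
    show "integrable M (\<lambda>\<omega>. ?I t \<omega> * h t (Y \<omega>))"
      by (rule indep_var_integrable[OF iv I int[OF t]])
    show "(LINT \<omega>|M. ?I t \<omega> * h t (Y \<omega>)) = measure M {\<omega> \<in> space M. T \<omega> = t} * (LINT \<omega>|M. h t (Y \<omega>))"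
      unfolding IL[symmetric] by (rule indep_var_lebesgue_integral[OF iv I int[OF t]])
  qed
  have eq: "h (T \<omega>) (Y \<omega>) = (\<Sum>t\<le>m. ?I t \<omega> * h t (Y \<omega>))" if "\<omega> \<in> space M" for \<omega>
  proof -
    have "T \<omega> \<le> m" using measurable_space[OF T that] by simp
    then have "(\<Sum>t\<le>m. ?I t \<omega> * h t (Y \<omega>)) = (\<Sum>t\<in>{T \<omega>}. ?I t \<omega> * h t (Y \<omega>))"
      by (intro sum.mono_neutral_right) auto
    then show ?thesis by simp
  qed
  show "integrable M (\<lambda>\<omega>. h (T \<omega>) (Y \<omega>))"
    by (subst Bochner_Integration.integrable_cong[OF refl eq])
      (assumption, intro Bochner_Integration.integrable_sum prod, simp)
  have "(LINT \<omega>|M. h (T \<omega>) (Y \<omega>)) = (LINT \<omega>|M. (\<Sum>t\<le>m. ?I t \<omega> * h t (Y \<omega>)))"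
    by (rule Bochner_Integration.integral_cong[OF refl eq])
  also have "\<dots> = (\<Sum>t\<le>m. LINT \<omega>|M. ?I t \<omega> * h t (Y \<omega>))"
    by (rule Bochner_Integration.integral_sum) (simp add: prod)
  also have "\<dots> = (\<Sum>t\<le>m. measure M {\<omega> \<in> space M. T \<omega> = t} * (LINT \<omega>|M. h t (Y \<omega>)))"
    by (rule sum.cong) (simp_all add: prod)
  finally show "(LINT \<omega>|M. h (T \<omega>) (Y \<omega>))
      = (\<Sum>t\<le>m. measure M {\<omega> \<in> space M. T \<omega> = t} * (LINT \<omega>|M. h t (Y \<omega>)))" .
qed

section \<open>The stochastic iteration\<close>

lemma sample_labels_0: "sample_labels b 0 = Init ` {..<b}"
  by (simp add: sample_labels_def)

lemma sample_labels_Suc: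
  "sample_labels b (Suc t) = insert (Zeta (Suc t)) (insert (Xi (Suc t)) (sample_labels b t))"
  by (auto simp: sample_labels_def atLeastAtMostSuc_conv)

lemma sample_labels_mono: "t \<le> t' \<Longrightarrow> sample_labels b t \<subseteq> sample_labels b t'"
  unfolding sample_labels_def by (intro Un_mono image_mono) auto

lemma finite_sample_labels: "finite (sample_labels b t)"
  by (simp add: sample_labels_def)

lemma fresh_labels:
  "Xi (Suc t) \<notin> sample_labels b t" "Zeta (Suc t) \<notin> insert (Xi (Suc t)) (sample_labels b t)"
  by (auto simp: sample_labels_def)

section \<open>Iterates and errors as functions of the sample sequence\<close>

locale hsgd = composite_problem f \<psi> L \<eta> Flow + P: prob_space P
  for f :: "'a::euclidean_space \<Rightarrow> real" and \<psi> :: "'a \<Rightarrow> ereal" and L \<eta> Flow :: real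
    and P :: "'s measure" +
  fixes fs :: "'s \<Rightarrow> 'a \<Rightarrow> real" and \<sigma> \<beta> :: real and \<gamma> :: "nat \<Rightarrow> real" and b m :: nat and x0 :: 'a
  assumes grad_cont: "\<And>\<xi>. \<xi> \<in> space P \<Longrightarrow> continuous_on UNIV (grad (fs \<xi>))"
    and grad_int: "\<And>y. integrable P (\<lambda>\<xi>. grad (fs \<xi>) y)"
    and grad_mean: "\<And>y. (LINT \<xi>|P. grad (fs \<xi>) y) = grad f y"
    and avg_int: "\<And>y z. y \<in> edom \<psi> \<Longrightarrow> z \<in> edom \<psi> \<Longrightarrow>
      integrable P (\<lambda>\<xi>. (norm (grad (fs \<xi>) y - grad (fs \<xi>) z))\<^sup>2)"
    and avg_lip: "\<And>y z. y \<in> edom \<psi> \<Longrightarrow> z \<in> edom \<psi> \<Longrightarrow>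
      (LINT \<xi>|P. (norm (grad (fs \<xi>) y - grad (fs \<xi>) z))\<^sup>2) \<le> L\<^sup>2 * (norm (y - z))\<^sup>2"
    and var_int: "\<And>y. y \<in> edom \<psi> \<Longrightarrow> integrable P (\<lambda>\<xi>. (norm (grad (fs \<xi>) y - grad f y))\<^sup>2)"
    and var_le: "\<And>y. y \<in> edom \<psi> \<Longrightarrow> (LINT \<xi>|P. (norm (grad (fs \<xi>) y - grad f y))\<^sup>2) \<le> \<sigma>\<^sup>2"
    and x0: "x0 \<in> edom \<psi>" and b: "0 < b"
    and \<gamma>: "\<And>t. t \<le> m \<Longrightarrow> 0 < \<gamma> t" "\<And>t. t \<le> m \<Longrightarrow> \<gamma> t \<le> 1"
begin

abbreviation X :: "nat \<Rightarrow> (sample_label \<Rightarrow> 's) \<Rightarrow> 'a" where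
  "X t s \<equiv> hsgd_x fs \<psi> x0 b (\<lambda>_. \<beta>) \<gamma> (\<lambda>_. \<eta>) s t"

abbreviation V :: "nat \<Rightarrow> (sample_label \<Rightarrow> 's) \<Rightarrow> 'a" where
  "V t s \<equiv> hsgd_v fs \<psi> x0 b (\<lambda>_. \<beta>) \<gamma> (\<lambda>_. \<eta>) s t"

definition err :: "nat \<Rightarrow> (sample_label \<Rightarrow> 's) \<Rightarrow> real" where
  "err t s = (norm (V t s - grad f (X t s)))\<^sup>2"

definition stp :: "nat \<Rightarrow> (sample_label \<Rightarrow> 's) \<Rightarrow> real" where
  "stp t s = (norm (prox \<eta> \<psi> (X t s - \<eta> *\<^sub>R V t s) - X t s))\<^sup>2"

definition gmap :: "nat \<Rightarrow> (sample_label \<Rightarrow> 's) \<Rightarrow> real" where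
  "gmap t s = (norm (grad_map \<eta> f \<psi> (X t s)))\<^sup>2"

lemma err_nonneg: "0 \<le> err t s" and stp_nonneg: "0 \<le> stp t s" and gmap_nonneg: "0 \<le> gmap t s"
  by (simp_all add: err_def stp_def gmap_def)

lemma X_edom: "t \<le> Suc m \<Longrightarrow> X t s \<in> edom \<psi>"
proof (induction t)
  case (Suc t)
  then show ?case
    using prox_step_edom[of "X t s" "\<gamma> t"] \<gamma>[of t] by (simp add: less_imp_le)
qed (simp add: x0)

lemma norm_X_diff: "(norm (X (Suc t) s - X t s))\<^sup>2 = (\<gamma> t)\<^sup>2 * stp t s"
proof -
  have "X (Suc t) s - X t s = \<gamma> t *\<^sub>R (prox \<eta> \<psi> (X t s - \<eta> *\<^sub>R V t s) - X t s)"
    by (simp add: algebra_simps)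
  then show ?thesis
    by (simp add: stp_def power_mult_distrib)
qed

text \<open>Adaptedness in functional form, in place of a filtration: the state at step
  \<open>t\<close> ignores all samples drawn later.\<close>

lemma XV_cong:
  "(\<And>i. i \<in> sample_labels b t \<Longrightarrow> s i = s' i) \<Longrightarrow> X t s = X t s' \<and> V t s = V t s'"
proof (induction t)
  case 0
  have "(\<Sum>i<b. grad (fs (s (Init i))) x0) = (\<Sum>i<b. grad (fs (s' (Init i))) x0)"
    using 0 by (intro sum.cong) (auto simp: sample_labels_0)
  then show ?case by simp
next
  case (Suc t)
  then have "X t s = X t s' \<and> V t s = V t s'"
    by (auto simp: sample_labels_Suc)
  moreover have "s (Xi (Suc t)) = s' (Xi (Suc t))" "s (Zeta (Suc t)) = s' (Zeta (Suc t))"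
    using Suc.prems by (auto simp: sample_labels_Suc)
  ultimately show ?case by simp
qed

text \<open>The off-by-one on which unbiasedness rests: \<open>X (Suc t)\<close> is fixed before the
  samples \<open>Xi (Suc t)\<close> and \<open>Zeta (Suc t)\<close> are drawn.\<close>

lemma X_Suc_cong:
  "(\<And>i. i \<in> sample_labels b t \<Longrightarrow> s i = s' i) \<Longrightarrow> X (Suc t) s = X (Suc t) s'"
  unfolding hsgd_x.simps(2) using XV_cong[of t s s'] by presburger

lemma err_stp_gmap_cong:
  assumes "\<And>i. i \<in> sample_labels b t \<Longrightarrow> s i = s' i"
  shows "err t s = err t s'" "stp t s = stp t s'" "gmap t s = gmap t s'"
  unfolding err_def stp_def gmap_def using XV_cong[of t s s', OF assms] by presburger+

lemma measurable_grad_fs: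
  assumes "Y \<in> measurable N P" "Z \<in> borel_measurable N"
  shows "(\<lambda>\<omega>. grad (fs (Y \<omega>)) (Z \<omega>)) \<in> borel_measurable N"
  by (rule borel_measurable_Caratheodory[OF borel_measurable_integrable[OF grad_int] grad_cont assms])

text \<open>Lipschitz continuity of \<open>grad f\<close> is available only on
  \<open>edom \<psi>\<close>; measurability everywhere comes from writing it as a parameter integral
  of the sampled gradients.\<close>

lemma measurable_grad_f [measurable]: "grad f \<in> borel_measurable borel"
proof -
  have "(\<lambda>(y, \<xi>). grad (fs \<xi>) y) \<in> borel_measurable (borel \<Otimes>\<^sub>M P)"
    unfolding case_prod_beta by (intro measurable_grad_fs) auto
  then have "(\<lambda>y. LINT \<xi>|P. grad (fs \<xi>) y) \<in> borel_measurable borel"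
    by (rule P.borel_measurable_lebesgue_integral)
  then show ?thesis
    by (simp add: grad_mean)
qed

lemma measurable_prox [measurable]: "prox \<eta> \<psi> \<in> borel_measurable borel"
proof (rule borel_measurable_continuous_onI)
  have "1-lipschitz_on UNIV (prox \<eta> \<psi>)"
    by (rule lipschitz_onI) (simp_all add: dist_norm prox_nonexpansive)
  then show "continuous_on UNIV (prox \<eta> \<psi>)"
    by (rule lipschitz_on_continuous_on)
qed

lemma measurable_XV:
  "sample_labels b t \<subseteq> I \<Longrightarrow>
    X t \<in> borel_measurable (Pi\<^sub>M I (\<lambda>_. P)) \<and> V t \<in> borel_measurable (Pi\<^sub>M I (\<lambda>_. P))"
proof (induction t)
  case 0
  then show ?case
    by (auto simp: sample_labels_0 intro!: borel_measurable_scaleR borel_measurable_sum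
        measurable_grad_fs measurable_component_singleton)
next
  case (Suc t)
  then have [measurable]: "X t \<in> borel_measurable (Pi\<^sub>M I (\<lambda>_. P))" "V t \<in> borel_measurable (Pi\<^sub>M I (\<lambda>_. P))"
    by (auto simp: sample_labels_Suc)
  have i: "Xi (Suc t) \<in> I" "Zeta (Suc t) \<in> I"
    using Suc.prems by (auto simp: sample_labels_Suc)
  have X: "X (Suc t) \<in> borel_measurable (Pi\<^sub>M I (\<lambda>_. P))"
    by simp
  have "(\<lambda>s. grad (fs (s i)) (Y s)) \<in> borel_measurable (Pi\<^sub>M I (\<lambda>_. P))"
    if "i \<in> I" "Y \<in> borel_measurable (Pi\<^sub>M I (\<lambda>_. P))" for i Y
    using that by (intro measurable_grad_fs measurable_component_singleton)
  note G = this[OF i(1) X] this[OF i(1), of "X t"] this[OF i(2) X]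
  have "V (Suc t) \<in> borel_measurable (Pi\<^sub>M I (\<lambda>_. P))"
    unfolding hsgd_v.simps
    by (intro borel_measurable_add borel_measurable_scaleR borel_measurable_diff G
       borel_measurable_const) measurable
  with X show ?case by blast
qed

lemma measurable_err_stp_gmap:
  assumes "sample_labels b t \<subseteq> I"
  shows "err t \<in> borel_measurable (Pi\<^sub>M I (\<lambda>_. P))" "stp t \<in> borel_measurable (Pi\<^sub>M I (\<lambda>_. P))"
    "gmap t \<in> borel_measurable (Pi\<^sub>M I (\<lambda>_. P))"
proof -
  have [measurable]: "X t \<in> borel_measurable (Pi\<^sub>M I (\<lambda>_. P))" "V t \<in> borel_measurable (Pi\<^sub>M I (\<lambda>_. P))"
    using measurable_XV[OF assms] by auto
  show "err t \<in> borel_measurable (Pi\<^sub>M I (\<lambda>_. P))" "stp t \<in> borel_measurable (Pi\<^sub>M I (\<lambda>_. P))"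
    "gmap t \<in> borel_measurable (Pi\<^sub>M I (\<lambda>_. P))"
    unfolding err_def stp_def gmap_def grad_map_def by measurable
qed

lemma PiM_sigma_finite: "product_sigma_finite (\<lambda>_::sample_label. P)"
  by (simp add: product_sigma_finite_def P.sigma_finite_measure_axioms)

lemma grad_noise:
  "integrable P (\<lambda>\<xi>. grad (fs \<xi>) y - grad f y)" "(LINT \<xi>|P. grad (fs \<xi>) y - grad f y) = 0"
  using grad_int[of y] grad_mean[of y] by (simp_all add: P.prob_space)

text \<open>Adds one batch member at a time: with the others fixed, the fresh centered term
  contributes at most \<sigma>^2 and no cross term.\<close>

lemma batch_variance:
  "n \<le> b \<Longrightarrow> (\<integral>\<^sup>+s. ennreal ((norm (\<Sum>i<n. grad (fs (s (Init i))) x0 - grad f x0))\<^sup>2)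
      \<partial>Pi\<^sub>M (Init ` {..<n}) (\<lambda>_. P)) \<le> ennreal (real n * \<sigma>\<^sup>2)"
proof (induction n)
  case 0
  then show ?case by simp
next
  case (Suc n)
  interpret product_sigma_finite "\<lambda>_::sample_label. P" by (rule PiM_sigma_finite)
  interpret J: prob_space "Pi\<^sub>M (Init ` {..<n}) (\<lambda>_. P)"
    by (rule prob_space_PiM) (rule P.prob_space_axioms)
  let ?Z = "\<lambda>\<xi>. grad (fs \<xi>) x0 - grad f x0"
  have ins: "Init ` {..<Suc n} = insert (Init n) (Init ` {..<n})"
    by (auto simp: lessThan_Suc)
  have M: "(\<lambda>s. \<Sum>i<k. ?Z (s (Init i))) \<in> borel_measurable (Pi\<^sub>M (Init ` {..<k}) (\<lambda>_. P))" for k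
    by (intro borel_measurable_sum borel_measurable_diff measurable_grad_fs
        measurable_component_singleton borel_measurable_const) auto
  have "(\<integral>\<^sup>+s. ennreal ((norm (\<Sum>i<Suc n. ?Z (s (Init i))))\<^sup>2) \<partial>Pi\<^sub>M (Init ` {..<Suc n}) (\<lambda>_. P))
      = (\<integral>\<^sup>+s. (\<integral>\<^sup>+\<xi>. ennreal ((norm (\<Sum>i<Suc n. ?Z ((s(Init n := \<xi>)) (Init i))))\<^sup>2) \<partial>P)
          \<partial>Pi\<^sub>M (Init ` {..<n}) (\<lambda>_. P))"
    unfolding ins using M[of "Suc n"] unfolding ins
    by (intro product_nn_integral_insert) auto
  also have "\<dots> \<le> (\<integral>\<^sup>+s. ennreal ((norm (\<Sum>i<n. ?Z (s (Init i))))\<^sup>2) + ennreal (\<sigma>\<^sup>2)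
          \<partial>Pi\<^sub>M (Init ` {..<n}) (\<lambda>_. P))"
  proof (rule nn_integral_mono)
    fix s
    have "(\<Sum>i<Suc n. ?Z ((s(Init n := \<xi>)) (Init i))) = (\<Sum>i<n. ?Z (s (Init i))) + 1 *\<^sub>R ?Z \<xi>" for \<xi>
      by simp
    then show "(\<integral>\<^sup>+\<xi>. ennreal ((norm (\<Sum>i<Suc n. ?Z ((s(Init n := \<xi>)) (Init i))))\<^sup>2) \<partial>P)
        \<le> ennreal ((norm (\<Sum>i<n. ?Z (s (Init i))))\<^sup>2) + ennreal (\<sigma>\<^sup>2)"
      using P.centered_nn_second_moment_le[OF grad_noise var_int[OF x0] var_le[OF x0],
          of "\<Sum>i<n. ?Z (s (Init i))" 1]
      by (simp only:) (simp add: ennreal_plus)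
  qed
  also have "\<dots> = (\<integral>\<^sup>+s. ennreal ((norm (\<Sum>i<n. ?Z (s (Init i))))\<^sup>2) \<partial>Pi\<^sub>M (Init ` {..<n}) (\<lambda>_. P)) + ennreal (\<sigma>\<^sup>2)"
    using M[of n] by (subst nn_integral_add) (auto simp: J.emeasure_space_1)
  also have "\<dots> \<le> ennreal (real n * \<sigma>\<^sup>2) + ennreal (\<sigma>\<^sup>2)"
    using Suc by (intro add_right_mono) simp
  also have "\<dots> = ennreal (real (Suc n) * \<sigma>\<^sup>2)"
    by (simp add: algebra_simps flip: ennreal_plus)
  finally show ?case .
qed

lemma err_0:
  "(\<integral>\<^sup>+s. ennreal (err 0 s) \<partial>Pi\<^sub>M (sample_labels b 0) (\<lambda>_. P)) \<le> ennreal (\<sigma>\<^sup>2 / real b)"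
proof -
  let ?Z = "\<lambda>s. \<Sum>i<b. grad (fs (s (Init i))) x0 - grad f x0"
  have eq: "err 0 s = (1 / real b)\<^sup>2 * (norm (?Z s))\<^sup>2" for s
  proof -
    have "V 0 s - grad f (X 0 s) = (1 / real b) *\<^sub>R ?Z s"
      using b by (simp add: sum_subtractf scaleR_diff_right sum_constant_scaleR)
    then show ?thesis
      by (simp add: err_def power_mult_distrib power_divide)
  qed
  have "?Z \<in> borel_measurable (Pi\<^sub>M (Init ` {..<b}) (\<lambda>_. P))"
    by (intro borel_measurable_sum borel_measurable_diff measurable_grad_fs
        measurable_component_singleton borel_measurable_const) auto
  then have "(\<integral>\<^sup>+s. ennreal (err 0 s) \<partial>Pi\<^sub>M (sample_labels b 0) (\<lambda>_. P))
      = ennreal ((1 / real b)\<^sup>2) * (\<integral>\<^sup>+s. ennreal ((norm (?Z s))\<^sup>2) \<partial>Pi\<^sub>M (Init ` {..<b}) (\<lambda>_. P))"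
    unfolding sample_labels_0 eq by (subst nn_integral_cmult[symmetric]) (auto simp: ennreal_mult)
  also have "\<dots> \<le> ennreal ((1 / real b)\<^sup>2) * ennreal (real b * \<sigma>\<^sup>2)"
    using batch_variance[of b] by (intro mult_left_mono) auto
  also have "\<dots> = ennreal (\<sigma>\<^sup>2 / real b)"
    using b by (simp add: power2_eq_square flip: ennreal_mult)
  finally show ?thesis .
qed

text \<open>Fubini on the product space takes the place of conditional expectations:
  \<open>Zeta (Suc t)\<close> is integrated out first, then \<open>Xi (Suc t)\<close>, with the
  earlier samples frozen. Both noises are centered, so the parts of the new error contribute without
  cross terms.\<close>

lemma err_Suc:
  assumes t: "t < m"
  shows "(\<integral>\<^sup>+s. ennreal (err (Suc t) s) \<partial>Pi\<^sub>M (sample_labels b (Suc t)) (\<lambda>_. P))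
    \<le> (\<integral>\<^sup>+s. ennreal (\<beta>\<^sup>2 * err t s + \<beta>\<^sup>2 * L\<^sup>2 * (\<gamma> t)\<^sup>2 * stp t s + (1 - \<beta>)\<^sup>2 * \<sigma>\<^sup>2)
        \<partial>Pi\<^sub>M (sample_labels b t) (\<lambda>_. P))"
proof -
  interpret product_sigma_finite "\<lambda>_::sample_label. P" by (rule PiM_sigma_finite)
  define J where "J = sample_labels b t"
  define i where "i = Xi (Suc t)"
  define j where "j = Zeta (Suc t)"
  have fin: "finite J" "i \<notin> J" "j \<notin> insert i J"
    unfolding J_def i_def j_def using finite_sample_labels fresh_labels by auto
  define Z where "Z s \<xi> = (grad (fs \<xi>) (X (Suc t) s) - grad (fs \<xi>) (X t s))
      - (grad f (X (Suc t) s) - grad f (X t s))" for s \<xi>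
  define A where "A s \<xi> = \<beta> *\<^sub>R (V t s - grad f (X t s)) + \<beta> *\<^sub>R Z s \<xi>" for s \<xi>
  have ed: "X t s \<in> edom \<psi>" "X (Suc t) s \<in> edom \<psi>" for s
    using t by (intro X_edom; simp)+
  \<comment> \<open>Subtracting the true gradient at the new point leaves three parts: the old error
    scaled by \<open>\<beta>\<close> and the centered \<open>Xi\<close> difference, both inside
    \<open>A\<close>, and the centered \<open>Zeta\<close> noise.\<close>
  have split: "V (Suc t) s - grad f (X (Suc t) s)
      = A s (s i) + (1 - \<beta>) *\<^sub>R (grad (fs (s j)) (X (Suc t) s) - grad f (X (Suc t) s))" for s
    unfolding hsgd_v.simps(2) A_def Z_def i_def j_def by (simp add: algebra_simps del: hsgd_x.simps(2))
  have upd: "X t (s(k := \<xi>)) = X t s" "V t (s(k := \<xi>)) = V t s" "X (Suc t) (s(k := \<xi>)) = X (Suc t) s"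
    if "k \<notin> J" for s k \<xi>
  proof -
    have agree: "\<And>l. l \<in> sample_labels b t \<Longrightarrow> (s(k := \<xi>)) l = s l"
      using that by (auto simp: J_def)
    from XV_cong[of t "s(k := \<xi>)" s, OF agree] X_Suc_cong[of t "s(k := \<xi>)" s, OF agree]
    show "X t (s(k := \<xi>)) = X t s" "V t (s(k := \<xi>)) = V t s" "X (Suc t) (s(k := \<xi>)) = X (Suc t) s"
      by blast+
  qed
  have A_upd: "A (s(k := \<xi>)) \<zeta> = A s \<zeta>" if "k \<notin> J" for s k \<xi> \<zeta>
    unfolding A_def Z_def upd[OF that] ..
  have meas_A: "(\<lambda>s. A s (s i)) \<in> borel_measurable (Pi\<^sub>M (insert i J) (\<lambda>_. P))"
  proof -
    have XV: "X t \<in> borel_measurable (Pi\<^sub>M (insert i J) (\<lambda>_. P))"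
      "V t \<in> borel_measurable (Pi\<^sub>M (insert i J) (\<lambda>_. P))"
      using measurable_XV[of t "insert i J"] by (auto simp: J_def)
    then have X': "X (Suc t) \<in> borel_measurable (Pi\<^sub>M (insert i J) (\<lambda>_. P))"
      by simp
    have "(\<lambda>s. grad (fs (s i)) (Y s)) \<in> borel_measurable (Pi\<^sub>M (insert i J) (\<lambda>_. P))"
      if "Y \<in> borel_measurable (Pi\<^sub>M (insert i J) (\<lambda>_. P))" for Y
      using that by (intro measurable_grad_fs measurable_component_singleton) auto
    then show ?thesis
      unfolding A_def Z_def using XV X'
      by (intro borel_measurable_add borel_measurable_scaleR borel_measurable_diff
          borel_measurable_const measurable_compose[OF _ measurable_grad_f])
  qed
  have "(\<integral>\<^sup>+s. ennreal (err (Suc t) s) \<partial>Pi\<^sub>M (sample_labels b (Suc t)) (\<lambda>_. P))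
      = (\<integral>\<^sup>+s. (\<integral>\<^sup>+\<zeta>. ennreal (err (Suc t) (s(j := \<zeta>))) \<partial>P) \<partial>Pi\<^sub>M (insert i J) (\<lambda>_. P))"
    using measurable_err_stp_gmap(1)[of "Suc t" "sample_labels b (Suc t)"] fin
    unfolding sample_labels_Suc J_def[symmetric] i_def[symmetric] j_def[symmetric]
    by (intro product_nn_integral_insert) auto
  also have "\<dots> \<le> (\<integral>\<^sup>+s. ennreal ((norm (A s (s i)))\<^sup>2 + (1 - \<beta>)\<^sup>2 * \<sigma>\<^sup>2) \<partial>Pi\<^sub>M (insert i J) (\<lambda>_. P))"
  proof (rule nn_integral_mono)
    fix s
    have "err (Suc t) (s(j := \<zeta>))
        = (norm (A s (s i) + (1 - \<beta>) *\<^sub>R (grad (fs \<zeta>) (X (Suc t) s) - grad f (X (Suc t) s))))\<^sup>2" for \<zeta>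
      using fin unfolding err_def split by (auto simp add: A_upd upd simp del: hsgd_x.simps(2))
    then show "(\<integral>\<^sup>+\<zeta>. ennreal (err (Suc t) (s(j := \<zeta>))) \<partial>P)
        \<le> ennreal ((norm (A s (s i)))\<^sup>2 + (1 - \<beta>)\<^sup>2 * \<sigma>\<^sup>2)"
      using P.centered_nn_second_moment_le[OF grad_noise var_int[OF ed(2)] var_le[OF ed(2)]]
      by (simp only:)
  qed
  also have "\<dots> = (\<integral>\<^sup>+s. (\<integral>\<^sup>+\<xi>. ennreal ((norm (A (s(i := \<xi>)) ((s(i := \<xi>)) i)))\<^sup>2 + (1 - \<beta>)\<^sup>2 * \<sigma>\<^sup>2) \<partial>P)
      \<partial>Pi\<^sub>M J (\<lambda>_. P))"
    using meas_A fin by (intro product_nn_integral_insert) auto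
  also have "\<dots> \<le> (\<integral>\<^sup>+s. ennreal (\<beta>\<^sup>2 * err t s + \<beta>\<^sup>2 * L\<^sup>2 * (\<gamma> t)\<^sup>2 * stp t s + (1 - \<beta>)\<^sup>2 * \<sigma>\<^sup>2)
        \<partial>Pi\<^sub>M J (\<lambda>_. P))"
  proof (rule nn_integral_mono)
    fix s
    let ?D = "\<lambda>\<xi>. grad (fs \<xi>) (X (Suc t) s) - grad (fs \<xi>) (X t s)"
    have D: "integrable P ?D" "(LINT \<xi>|P. ?D \<xi>) = grad f (X (Suc t) s) - grad f (X t s)"
      using grad_int by (simp_all add: grad_mean del: hsgd_x.simps(2))
    note var = P.variance_le_second_moment[OF D(1) avg_int[OF ed(2,1)], unfolded D(2), folded Z_def]
    \<comment> \<open>Centering only lowers the second moment, so the mean-square Lipschitz bound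
      holds for \<open>Z\<close> too; the squared displacement of the iterate is
      \<open>(\<gamma> t)\<^sup>2 * stp t s\<close>.\<close>
    have le: "(LINT \<xi>|P. (norm (Z s \<xi>))\<^sup>2) \<le> L\<^sup>2 * ((\<gamma> t)\<^sup>2 * stp t s)"
      using var(4) avg_lip[OF ed(2,1), of s s] zero_le_power2[of "norm (grad f (X (Suc t) s) - grad f (X t s))"]
      unfolding norm_X_diff by linarith
    have "(\<integral>\<^sup>+\<xi>. ennreal ((norm (A s \<xi>))\<^sup>2) \<partial>P)
        \<le> ennreal ((norm (\<beta> *\<^sub>R (V t s - grad f (X t s))))\<^sup>2 + \<beta>\<^sup>2 * (L\<^sup>2 * ((\<gamma> t)\<^sup>2 * stp t s)))"
      unfolding A_def by (rule P.centered_nn_second_moment_le[OF var(1,2,3) le])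
    also have "\<dots> = ennreal (\<beta>\<^sup>2 * err t s + \<beta>\<^sup>2 * L\<^sup>2 * (\<gamma> t)\<^sup>2 * stp t s)"
      by (simp add: err_def power_mult_distrib mult.assoc)
    finally have "(\<integral>\<^sup>+\<xi>. ennreal ((norm (A s \<xi>))\<^sup>2) \<partial>P) + ennreal ((1 - \<beta>)\<^sup>2 * \<sigma>\<^sup>2)
        \<le> ennreal (\<beta>\<^sup>2 * err t s + \<beta>\<^sup>2 * L\<^sup>2 * (\<gamma> t)\<^sup>2 * stp t s) + ennreal ((1 - \<beta>)\<^sup>2 * \<sigma>\<^sup>2)"
      by (rule add_right_mono)
    moreover have "A s \<in> borel_measurable P"
      unfolding A_def using var(1) by (intro borel_measurable_add borel_measurable_scaleR
          borel_measurable_const) auto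
    then have "(\<integral>\<^sup>+\<xi>. ennreal ((norm (A s \<xi>))\<^sup>2 + (1 - \<beta>)\<^sup>2 * \<sigma>\<^sup>2) \<partial>P)
        = (\<integral>\<^sup>+\<xi>. ennreal ((norm (A s \<xi>))\<^sup>2) \<partial>P) + ennreal ((1 - \<beta>)\<^sup>2 * \<sigma>\<^sup>2)"
      by (simp add: nn_integral_add P.emeasure_space_1)
    moreover have "A (s(i := \<xi>)) ((s(i := \<xi>)) i) = A s \<xi>" for \<xi>
      using A_upd[OF fin(2)] by simp
    moreover have "ennreal (\<beta>\<^sup>2 * err t s + \<beta>\<^sup>2 * L\<^sup>2 * (\<gamma> t)\<^sup>2 * stp t s + (1 - \<beta>)\<^sup>2 * \<sigma>\<^sup>2)
        = ennreal (\<beta>\<^sup>2 * err t s + \<beta>\<^sup>2 * L\<^sup>2 * (\<gamma> t)\<^sup>2 * stp t s) + ennreal ((1 - \<beta>)\<^sup>2 * \<sigma>\<^sup>2)"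
      using err_nonneg[of t s] stp_nonneg[of t s] by (intro ennreal_plus) auto
    ultimately show "(\<integral>\<^sup>+\<xi>. ennreal ((norm (A (s(i := \<xi>)) ((s(i := \<xi>)) i)))\<^sup>2 + (1 - \<beta>)\<^sup>2 * \<sigma>\<^sup>2) \<partial>P)
        \<le> ennreal (\<beta>\<^sup>2 * err t s + \<beta>\<^sup>2 * L\<^sup>2 * (\<gamma> t)\<^sup>2 * stp t s + (1 - \<beta>)\<^sup>2 * \<sigma>\<^sup>2)"
      by (simp only:)
  qed
  finally show ?thesis
    by (simp add: J_def)
qed

lemma pathwise_descent:
  "n \<le> Suc m \<Longrightarrow> f (X n s) + real_of_ereal (\<psi> (X n s))
      + (\<Sum>t<n. \<gamma> t * (L * \<eta>\<^sup>2 / 8 * gmap t s)) + (\<Sum>t<n. \<gamma> t * ((1 / \<eta> - L - L * \<gamma> t / 2) * stp t s))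
    \<le> f x0 + real_of_ereal (\<psi> x0) + (\<Sum>t<n. \<gamma> t * ((1 / (3 * L) + L * \<eta>\<^sup>2 / 4) * err t s))"
proof (induction n)
  case (Suc n)
  then have n: "n \<le> m" by simp
  have ed: "X n s \<in> edom \<psi>"
    by (rule X_edom) (rule le_SucI[OF n])
  note step = one_step[OF ed less_imp_le[OF \<gamma>(1)[OF n]] \<gamma>(2)[OF n], of "V n s",
      folded err_def stp_def gmap_def]
  show ?case
    unfolding sum.lessThan_Suc hsgd_x.simps(2) using step Suc.IH[OF le_SucI[OF n]] by linarith
qed simp

end

section \<open>Transfer to the probability space of the run\<close>

locale hsgd_run = hsgd f \<psi> L \<eta> Flow P fs \<sigma> \<beta> \<gamma> b m x0 + M: prob_space M
  for f :: "'a::euclidean_space \<Rightarrow> real" and \<psi> :: "'a \<Rightarrow> ereal" and L \<eta> Flow :: real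
    and P :: "'s measure" and fs :: "'s \<Rightarrow> 'a \<Rightarrow> real" and \<sigma> \<beta> :: real and \<gamma> :: "nat \<Rightarrow> real"
    and b m :: nat and x0 :: 'a and M :: "'w measure" +
  fixes S :: "sample_label \<Rightarrow> 'w \<Rightarrow> 's"
  assumes samples: "iid_samples M P (sample_labels b m) S"
begin

text \<open>Restriction to the labels seen by step \<open>t\<close> makes the tuple a point of the
  finite product space. Quantities up to step \<open>t\<close> do not notice it, by
  \<open>eval_smp\<close>.\<close>

definition smp :: "nat \<Rightarrow> 'w \<Rightarrow> sample_label \<Rightarrow> 's" where
  "smp t \<omega> = (\<lambda>i\<in>sample_labels b t. S i \<omega>)"

lemma S_measurable: "i \<in> sample_labels b m \<Longrightarrow> S i \<in> measurable M P"
  using samples by (auto simp: iid_samples_def M.indep_vars_def)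

lemma smp_measurable: "t \<le> m \<Longrightarrow> smp t \<in> measurable M (Pi\<^sub>M (sample_labels b t) (\<lambda>_. P))"
  unfolding smp_def using sample_labels_mono[of t m b]
  by (intro measurable_restrict S_measurable) auto

text \<open>For a nonempty label set, independence says that the joint law is the product of the
  marginals; a positive batch size supplies a label.\<close>

lemma smp_distr:
  assumes t: "t \<le> m"
  shows "distr M (Pi\<^sub>M (sample_labels b t) (\<lambda>_. P)) (smp t) = Pi\<^sub>M (sample_labels b t) (\<lambda>_. P)"
proof -
  have sub: "sample_labels b t \<subseteq> sample_labels b m"
    by (rule sample_labels_mono[OF t])
  have ne: "sample_labels b t \<noteq> {}"
    using b by (auto simp: sample_labels_def)
  have ind: "M.indep_vars (\<lambda>_. P) S (sample_labels b t)"
    using samples sub by (auto simp: iid_samples_def intro: M.indep_vars_subset)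
  have "distr M (Pi\<^sub>M (sample_labels b t) (\<lambda>_. P)) (\<lambda>\<omega>. \<lambda>i\<in>sample_labels b t. S i \<omega>)
      = Pi\<^sub>M (sample_labels b t) (\<lambda>i. distr M P (S i))"
    using ind sub by (subst (asm) M.indep_vars_iff_distr_eq_PiM'[OF ne]) (auto intro: S_measurable)
  also have "\<dots> = Pi\<^sub>M (sample_labels b t) (\<lambda>_. P)"
    using samples sub by (intro PiM_cong) (auto simp: iid_samples_def)
  finally show ?thesis
    by (simp add: smp_def[abs_def])
qed

lemma nn_integral_smp:
  assumes "t \<le> m" "h \<in> borel_measurable (Pi\<^sub>M (sample_labels b t) (\<lambda>_. P))"
  shows "(\<integral>\<^sup>+\<omega>. h (smp t \<omega>) \<partial>M) = (\<integral>\<^sup>+s. h s \<partial>Pi\<^sub>M (sample_labels b t) (\<lambda>_. P))"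
  using assms by (subst smp_distr[OF assms(1), symmetric], subst nn_integral_distr) (auto intro: smp_measurable)

abbreviation "e t \<omega> \<equiv> err t (\<lambda>i. S i \<omega>)"
abbreviation "d t \<omega> \<equiv> stp t (\<lambda>i. S i \<omega>)"
abbreviation "G t \<omega> \<equiv> gmap t (\<lambda>i. S i \<omega>)"

lemma eval_smp:
  assumes "t \<le> n"
  shows "err t (smp n \<omega>) = e t \<omega>" "stp t (smp n \<omega>) = d t \<omega>" "gmap t (smp n \<omega>) = G t \<omega>"
  using sample_labels_mono[OF assms, of b]
  by (auto intro!: err_stp_gmap_cong simp: smp_def)

lemma measurable_edG:
  assumes "t \<le> m"
  shows "e t \<in> borel_measurable M" "d t \<in> borel_measurable M" "G t \<in> borel_measurable M"
  using measurable_compose[OF smp_measurable[OF assms] measurable_err_stp_gmap(1)[OF order_refl]]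
    measurable_compose[OF smp_measurable[OF assms] measurable_err_stp_gmap(2)[OF order_refl]]
    measurable_compose[OF smp_measurable[OF assms] measurable_err_stp_gmap(3)[OF order_refl]]
  by (simp_all add: eval_smp)

lemma expected_err_0: "integrable M (e 0)" "(LINT \<omega>|M. e 0 \<omega>) \<le> \<sigma>\<^sup>2 / real b"
proof -
  have "(\<integral>\<^sup>+\<omega>. ennreal (e 0 \<omega>) \<partial>M) = (\<integral>\<^sup>+s. ennreal (err 0 s) \<partial>Pi\<^sub>M (sample_labels b 0) (\<lambda>_. P))"
    using nn_integral_smp[of 0 "\<lambda>s. ennreal (err 0 s)"] measurable_err_stp_gmap(1)[of 0, OF order_refl]
    by (simp add: eval_smp)
  also have "\<dots> \<le> (\<integral>\<^sup>+\<omega>. ennreal (\<sigma>\<^sup>2 / real b) \<partial>M)"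
    using err_0 by (simp add: M.emeasure_space_1)
  finally have le: "(\<integral>\<^sup>+\<omega>. ennreal (e 0 \<omega>) \<partial>M) \<le> (\<integral>\<^sup>+\<omega>. ennreal (\<sigma>\<^sup>2 / real b) \<partial>M)" .
  note * = integral_le_of_nn_integral_le[OF M.integrable_const _ measurable_edG(1) err_nonneg le]
  show "integrable M (e 0)"
    by (rule *(1)) simp_all
  show "(LINT \<omega>|M. e 0 \<omega>) \<le> \<sigma>\<^sup>2 / real b"
    using *(2) by (simp add: M.prob_space)
qed

lemma expected_err_Suc:
  assumes t: "t < m" and int: "integrable M (e t)" "integrable M (d t)"
  shows "integrable M (e (Suc t))"
    and "(LINT \<omega>|M. e (Suc t) \<omega>) \<le> \<beta>\<^sup>2 * (LINT \<omega>|M. e t \<omega>)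
      + (\<beta>\<^sup>2 * L\<^sup>2 * (\<gamma> t)\<^sup>2 * (LINT \<omega>|M. d t \<omega>) + (1 - \<beta>)\<^sup>2 * \<sigma>\<^sup>2)"
proof -
  let ?g = "\<lambda>s. \<beta>\<^sup>2 * err t s + \<beta>\<^sup>2 * L\<^sup>2 * (\<gamma> t)\<^sup>2 * stp t s + (1 - \<beta>)\<^sup>2 * \<sigma>\<^sup>2"
  have tm: "t \<le> m" "Suc t \<le> m" using t by simp_all
  have "(\<integral>\<^sup>+\<omega>. ennreal (e (Suc t) \<omega>) \<partial>M)
      = (\<integral>\<^sup>+s. ennreal (err (Suc t) s) \<partial>Pi\<^sub>M (sample_labels b (Suc t)) (\<lambda>_. P))"
    using nn_integral_smp[OF tm(2), of "\<lambda>s. ennreal (err (Suc t) s)"]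
      measurable_err_stp_gmap(1)[of "Suc t", OF order_refl]
    by (simp add: eval_smp)
  also have "\<dots> \<le> (\<integral>\<^sup>+s. ennreal (?g s) \<partial>Pi\<^sub>M (sample_labels b t) (\<lambda>_. P))"
    by (rule err_Suc[OF t])
  also have "\<dots> = (\<integral>\<^sup>+\<omega>. ennreal (?g (\<lambda>i. S i \<omega>)) \<partial>M)"
    using nn_integral_smp[OF tm(1), of "\<lambda>s. ennreal (?g s)"] measurable_err_stp_gmap(1,2)[of t, OF order_refl]
    by (simp add: eval_smp)
  finally have le: "(\<integral>\<^sup>+\<omega>. ennreal (e (Suc t) \<omega>) \<partial>M) \<le> (\<integral>\<^sup>+\<omega>. ennreal (?g (\<lambda>i. S i \<omega>)) \<partial>M)" .
  have gi: "integrable M (\<lambda>\<omega>. ?g (\<lambda>i. S i \<omega>))"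
    using int by (intro Bochner_Integration.integrable_add integrable_mult_right M.integrable_const)
  have g0: "0 \<le> ?g (\<lambda>i. S i \<omega>)" for \<omega>
    using err_nonneg stp_nonneg by (intro add_nonneg_nonneg mult_nonneg_nonneg) auto
  note * = integral_le_of_nn_integral_le[OF gi g0 measurable_edG(1)[OF tm(2)] err_nonneg le]
  show "integrable M (e (Suc t))"
    by (rule *(1))
  show "(LINT \<omega>|M. e (Suc t) \<omega>) \<le> \<beta>\<^sup>2 * (LINT \<omega>|M. e t \<omega>)
      + (\<beta>\<^sup>2 * L\<^sup>2 * (\<gamma> t)\<^sup>2 * (LINT \<omega>|M. d t \<omega>) + (1 - \<beta>)\<^sup>2 * \<sigma>\<^sup>2)"
    using *(2) int by (simp add: M.prob_space)
qed

abbreviation "\<Delta>F \<equiv> f x0 + real_of_ereal (\<psi> x0) - Flow"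
abbreviation "\<kappa> \<equiv> 1 / (3 * L) + L * \<eta>\<^sup>2 / 4"
abbreviation "C t \<equiv> 1 / \<eta> - L - L * \<gamma> t / 2"

lemma pathwise_sum_le:
  assumes "n \<le> m"
  shows "(\<Sum>t\<le>n. \<gamma> t * (L * \<eta>\<^sup>2 / 8 * G t \<omega>)) + (\<Sum>t\<le>n. \<gamma> t * (C t * d t \<omega>))
    \<le> \<Delta>F + (\<Sum>t\<le>n. \<gamma> t * (\<kappa> * e t \<omega>))"
  using pathwise_descent[of "Suc n" "\<lambda>i. S i \<omega>"] lower[OF X_edom[of "Suc n" "\<lambda>i. S i \<omega>"]] assms
  unfolding lessThan_Suc_atMost by linarith

context
  assumes C_nonneg: "\<And>t. t \<le> m \<Longrightarrow> 0 \<le> C t" and C_pos: "\<And>t. t < m \<Longrightarrow> 0 < C t"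
begin

text \<open>All summands on the left of the pathwise bound are nonnegative, so each is dominated by
  the right side, which involves errors up to time \<open>t\<close> only. This is the a priori bound
  behind integrability.\<close>

lemma single_term_le:
  assumes t: "t \<le> m"
  shows "\<gamma> t * (L * \<eta>\<^sup>2 / 8) * G t \<omega> \<le> \<Delta>F + (\<Sum>i\<le>t. \<gamma> i * (\<kappa> * e i \<omega>))"
    and "\<gamma> t * C t * d t \<omega> \<le> \<Delta>F + (\<Sum>i\<le>t. \<gamma> i * (\<kappa> * e i \<omega>))"
proof -
  have 1: "0 \<le> \<gamma> i * (L * \<eta>\<^sup>2 / 8 * G i \<omega>)" "0 \<le> \<gamma> i * (C i * d i \<omega>)" if "i \<le> t" for i
    using that t \<gamma>(1)[of i] C_nonneg[of i] L gmap_nonneg stp_nonneg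
    by (auto intro!: mult_nonneg_nonneg less_imp_le)
  then have "0 \<le> (\<Sum>i\<le>t. \<gamma> i * (L * \<eta>\<^sup>2 / 8 * G i \<omega>))" "0 \<le> (\<Sum>i\<le>t. \<gamma> i * (C i * d i \<omega>))"
    by (auto intro!: sum_nonneg)
  moreover have "\<gamma> t * (L * \<eta>\<^sup>2 / 8 * G t \<omega>) \<le> (\<Sum>i\<le>t. \<gamma> i * (L * \<eta>\<^sup>2 / 8 * G i \<omega>))"
    using 1 by (intro member_le_sum) auto
  moreover have "\<gamma> t * (C t * d t \<omega>) \<le> (\<Sum>i\<le>t. \<gamma> i * (C i * d i \<omega>))"
    by (rule member_le_sum) (use 1 in auto)
  ultimately show "\<gamma> t * (L * \<eta>\<^sup>2 / 8) * G t \<omega> \<le> \<Delta>F + (\<Sum>i\<le>t. \<gamma> i * (\<kappa> * e i \<omega>))"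
    and "\<gamma> t * C t * d t \<omega> \<le> \<Delta>F + (\<Sum>i\<le>t. \<gamma> i * (\<kappa> * e i \<omega>))"
    using pathwise_sum_le[OF t, of \<omega>] unfolding mult.assoc by linarith+
qed

lemma integrable_bound_sum:
  assumes "\<And>i. i \<le> t \<Longrightarrow> integrable M (e i)"
  shows "integrable M (\<lambda>\<omega>. \<Delta>F + (\<Sum>i\<le>t. \<gamma> i * (\<kappa> * e i \<omega>)))"
  using assms by (intro Bochner_Integration.integrable_add M.integrable_const
      Bochner_Integration.integrable_sum integrable_mult_right) auto

text \<open>Division by \<open>C t\<close> requires it to be positive, hence \<open>t < m\<close>:
  for the prescribed weights \<open>C m\<close> is zero.\<close>

lemma integrable_d:
  assumes t: "t < m" and e: "\<And>i. i \<le> t \<Longrightarrow> integrable M (e i)"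
  shows "integrable M (d t)"
  by (rule integrable_of_scaled_le[OF _ measurable_edG(2) stp_nonneg single_term_le(2) integrable_bound_sum[OF e]])
    (use t \<gamma>(1)[of t] C_pos[of t] in auto)

text \<open>Strong induction: integrable errors up to \<open>k\<close> make \<open>d k\<close>
  integrable by the pathwise bound, and the error recursion then gives integrability of
  \<open>e (Suc k)\<close>.\<close>

lemma integrable_e: "t \<le> m \<Longrightarrow> integrable M (e t)"
proof (induction t rule: less_induct)
  case (less t)
  show ?case
  proof (cases t)
    case 0
    then show ?thesis using expected_err_0 by simp
  next
    case (Suc k)
    have *: "integrable M (e i)" if "i \<le> k" for i
      using less that Suc by simp
    have k: "k < m" using less Suc by simp
    show ?thesis
      unfolding Suc by (rule expected_err_Suc(1)[OF k *[OF order_refl] integrable_d[OF k *]])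
  qed
qed

lemma integrable_G: "t \<le> m \<Longrightarrow> integrable M (G t)"
  by (rule integrable_of_scaled_le[OF _ measurable_edG(3) gmap_nonneg single_term_le(1) integrable_bound_sum])
    (use \<gamma>(1)[of t] L eta integrable_e in auto)

lemma expected_sum_le:
  "(\<Sum>t\<le>m. \<gamma> t * (L * \<eta>\<^sup>2 / 8 * (LINT \<omega>|M. G t \<omega>))) + (\<Sum>t<m. \<gamma> t * (C t * (LINT \<omega>|M. d t \<omega>)))
    \<le> \<Delta>F + \<kappa> * (\<Sum>t\<le>m. \<gamma> t * (LINT \<omega>|M. e t \<omega>))"
proof -
  have d: "integrable M (d t)" if "t < m" for t
    using that integrable_e by (intro integrable_d) auto
  have pw: "(\<Sum>t\<le>m. \<gamma> t * (L * \<eta>\<^sup>2 / 8 * G t \<omega>)) + (\<Sum>t<m. \<gamma> t * (C t * d t \<omega>))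
      \<le> \<Delta>F + (\<Sum>t\<le>m. \<gamma> t * (\<kappa> * e t \<omega>))" for \<omega>
  proof -
    \<comment> \<open>The term at \<open>m\<close> is dropped, so that only step lengths known to be
      integrable remain.\<close>
    have "0 \<le> \<gamma> m * (C m * d m \<omega>)"
      using \<gamma>(1)[of m] C_nonneg[of m] stp_nonneg by (intro mult_nonneg_nonneg) auto
    moreover have "(\<Sum>t\<le>m. \<gamma> t * (C t * d t \<omega>)) = (\<Sum>t<m. \<gamma> t * (C t * d t \<omega>)) + \<gamma> m * (C m * d m \<omega>)"
      by (simp flip: lessThan_Suc_atMost)
    ultimately show ?thesis
      using pathwise_sum_le[of m \<omega>] by linarith
  qed
  have i1: "integrable M (\<lambda>\<omega>. \<Sum>t\<le>m. \<gamma> t * (L * \<eta>\<^sup>2 / 8 * G t \<omega>))"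
    by (intro Bochner_Integration.integrable_sum integrable_mult_right integrable_G) auto
  have i2: "integrable M (\<lambda>\<omega>. \<Sum>t<m. \<gamma> t * (C t * d t \<omega>))"
    by (intro Bochner_Integration.integrable_sum integrable_mult_right d) auto
  have i3: "integrable M (\<lambda>\<omega>. \<Sum>t\<le>m. \<gamma> t * (\<kappa> * e t \<omega>))"
    by (intro Bochner_Integration.integrable_sum integrable_mult_right integrable_e) auto
  have "(LINT \<omega>|M. (\<Sum>t\<le>m. \<gamma> t * (L * \<eta>\<^sup>2 / 8 * G t \<omega>)) + (\<Sum>t<m. \<gamma> t * (C t * d t \<omega>)))
      \<le> (LINT \<omega>|M. \<Delta>F + (\<Sum>t\<le>m. \<gamma> t * (\<kappa> * e t \<omega>)))"
    by (intro integral_mono Bochner_Integration.integrable_add i1 i2 i3 M.integrable_const pw)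
  also have "(LINT \<omega>|M. (\<Sum>t\<le>m. \<gamma> t * (L * \<eta>\<^sup>2 / 8 * G t \<omega>)) + (\<Sum>t<m. \<gamma> t * (C t * d t \<omega>)))
      = (\<Sum>t\<le>m. \<gamma> t * (L * \<eta>\<^sup>2 / 8 * (LINT \<omega>|M. G t \<omega>))) + (\<Sum>t<m. \<gamma> t * (C t * (LINT \<omega>|M. d t \<omega>)))"
    unfolding Bochner_Integration.integral_add[OF i1 i2]
    by (intro arg_cong2[where f="(+)"];
        subst Bochner_Integration.integral_sum; auto intro!: integrable_mult_right integrable_G d)
  also have "(LINT \<omega>|M. \<Delta>F + (\<Sum>t\<le>m. \<gamma> t * (\<kappa> * e t \<omega>)))
      = \<Delta>F + (LINT \<omega>|M. (\<Sum>t\<le>m. \<gamma> t * (\<kappa> * e t \<omega>)))"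
    by (subst Bochner_Integration.integral_add[OF M.integrable_const i3]) (simp add: M.prob_space)
  also have "(LINT \<omega>|M. (\<Sum>t\<le>m. \<gamma> t * (\<kappa> * e t \<omega>))) = (\<Sum>t\<le>m. \<gamma> t * (\<kappa> * (LINT \<omega>|M. e t \<omega>)))"
    by (subst Bochner_Integration.integral_sum) (auto intro!: integrable_mult_right integrable_e)
  also have "\<dots> = \<kappa> * (\<Sum>t\<le>m. \<gamma> t * (LINT \<omega>|M. e t \<omega>))"
    unfolding sum_distrib_left by (intro sum.cong refl) (rule mult.left_commute)
  finally show ?thesis .
qed

end

end

section \<open>Consequences of the prescribed momentum and step sizes\<close>

context hsgd_run
begin

context
  fixes \<delta> a :: real
  assumes a_def: "a = 1 / sqrt (real b * real (m + 1))" and \<beta>_def: "\<beta> = 1 - a" and \<beta>: "0 < \<beta>" "\<beta> < 1"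
    and \<delta>_def: "\<delta> = 2 / \<eta> - 2 * L"
    and \<gamma>_m: "\<gamma> m = \<delta> / L"
    and \<gamma>_rec: "\<forall>t<m.
      \<gamma> t = \<delta> / (L + L * (1 + L\<^sup>2 * \<eta>\<^sup>2) * (\<Sum>j=t+1..m. \<beta> ^ (2 * (j - t)) * \<gamma> j))"
begin

lemma eta_L: "L\<^sup>2 * \<eta>\<^sup>2 \<le> 1"
proof -
  have "(\<eta> * L)\<^sup>2 \<le> 1\<^sup>2" using eta L by (intro power_mono) auto
  then show ?thesis by (simp add: power_mult_distrib mult.commute)
qed

lemma delta_pos: "0 < \<delta>"
  using \<gamma>(1)[of m] \<gamma>_m L by (simp add: zero_less_divide_iff)

interpretation w: step_weights \<gamma> m "1 + L\<^sup>2 * \<eta>\<^sup>2" "\<delta> / L" "\<beta>\<^sup>2"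
proof
  show "\<beta>\<^sup>2 < 1" using \<beta> by (simp add: power_less_one_iff)
  show "\<delta> / L \<le> 1" using \<gamma>(2)[of m] \<gamma>_m by simp
  fix t assume "t < m"
  from \<gamma>_rec[rule_format, OF this] show "\<gamma> t = \<delta> / L / (1 + (1 + L\<^sup>2 * \<eta>\<^sup>2) * \<beta>\<^sup>2 * disc_tail (\<beta>\<^sup>2) \<gamma> m (Suc t))"
    unfolding disc_tail_shift using L by (simp add: distrib_left mult.assoc)
qed (use eta_L delta_pos L \<beta> \<gamma> \<gamma>_m in auto)

text \<open>\<open>\<beta> > 0\<close> forces the integer \<open>b * (m + 1)\<close> to exceed 1, so
  it is at least 2 and \<open>a\<^sup>2 \<le> 1 / 2\<close>. The resulting
  \<open>\<beta> \<ge> 1 / 4\<close> closes the noise estimate.\<close>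

lemma a_pos: "0 < a" and a_sq: "a\<^sup>2 = 1 / (real b * real (m + 1))" and a_le: "a \<le> 3 / 4"
proof -
  show "0 < a" using \<beta> \<beta>_def by simp
  show sq: "a\<^sup>2 = 1 / (real b * real (m + 1))"
    by (simp add: a_def power_divide)
  have "a < 1" using \<beta> \<beta>_def by simp
  then have "a\<^sup>2 < 1"
    using \<open>0 < a\<close> by (simp add: power_less_one_iff)
  then have "1 < real b * real (m + 1)"
    unfolding sq using b by (subst (asm) divide_less_eq_1_pos) simp_all
  then have "1 < b * (m + 1)"
    by (metis of_nat_1 of_nat_less_iff of_nat_mult)
  then have "2 \<le> b * (m + 1)" by simp
  then have "2 \<le> real b * real (m + 1)"
    by (metis of_nat_le_iff of_nat_mult of_nat_numeral)
  then have "a\<^sup>2 \<le> 1 / 2"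
    unfolding sq by (intro divide_left_mono) auto
  also have "1 / 2 \<le> (3 / 4 :: real)\<^sup>2" by (simp add: power2_eq_square)
  finally show "a \<le> 3 / 4" by (rule power2_le_imp_le) simp
qed

lemma one_minus_q: "1 - \<beta>\<^sup>2 = a * (1 + \<beta>)"
  using \<beta>_def by algebra

text \<open>The step-size rule solves exactly this balance: times \<open>\<gamma> t\<close>, the
  coefficient of the step length matches, up to a constant factor, the weight that the error
  recursion puts on it.\<close>

lemma C_eq: "t < m \<Longrightarrow> C t = L * (1 + L\<^sup>2 * \<eta>\<^sup>2) / 2 * \<gamma> t * (\<beta>\<^sup>2 * w.R (Suc t))"
proof -
  assume "t < m"
  from w.weight_mult[OF this] have "L * (\<gamma> t * (1 + (1 + L\<^sup>2 * \<eta>\<^sup>2) * \<beta>\<^sup>2 * w.R (Suc t))) = \<delta>"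
    using L by (simp add: field_simps)
  then have "\<delta> / 2 - L * \<gamma> t / 2 = L * (1 + L\<^sup>2 * \<eta>\<^sup>2) / 2 * \<gamma> t * (\<beta>\<^sup>2 * w.R (Suc t))"
    by (simp add: algebra_simps)
  moreover have "C t = \<delta> / 2 - L * \<gamma> t / 2"
    by (simp add: \<delta>_def)
  ultimately show ?thesis by simp
qed

lemma C_weights_pos: "t < m \<Longrightarrow> 0 < C t"
  unfolding C_eq using L w.R_pos[of "Suc t"] \<gamma>(1)[of t] \<beta>
  by (intro mult_pos_pos divide_pos_pos add_pos_nonneg) auto

lemma C_weights_nonneg: "t \<le> m \<Longrightarrow> 0 \<le> C t"
proof (cases "t = m")
  case True
  then show ?thesis using L \<gamma>_m \<delta>_def by simp
qed (use C_weights_pos[of t] in auto)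

lemma run_integrable_e: "t \<le> m \<Longrightarrow> integrable M (e t)"
  by (rule integrable_e; (rule C_weights_nonneg C_weights_pos)?; assumption)

lemma run_integrable_d: "t < m \<Longrightarrow> integrable M (d t)"
  by (rule integrable_d; (rule C_weights_nonneg C_weights_pos run_integrable_e)?; simp)

lemma run_integrable_G: "t \<le> m \<Longrightarrow> integrable M (G t)"
  by (rule integrable_G; (rule C_weights_nonneg C_weights_pos)?; assumption)

lemma run_expected_sum_le:
  "(\<Sum>t\<le>m. \<gamma> t * (L * \<eta>\<^sup>2 / 8 * (LINT \<omega>|M. G t \<omega>))) + (\<Sum>t<m. \<gamma> t * (C t * (LINT \<omega>|M. d t \<omega>)))
    \<le> \<Delta>F + \<kappa> * (\<Sum>t\<le>m. \<gamma> t * (LINT \<omega>|M. e t \<omega>))"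
  by (rule expected_sum_le; rule C_weights_nonneg C_weights_pos; assumption)

text \<open>The step lengths produced by the error recursion are absorbed by \<open>C t\<close>.
  Initial error and accumulated noise are measured against \<open>Y = a * W / (1 + \<beta>)\<close>,
  with factors 9/8 and 1. Their sum 17/8 times the bound 7/12 for \<open>L * \<kappa>\<close> is
  119/96, which is below \<open>1 + \<beta>\<close>.\<close>

lemma weighted_gradient_mapping_le:
  "(\<Sum>t\<le>m. \<gamma> t * (L * \<eta>\<^sup>2 / 8 * (LINT \<omega>|M. G t \<omega>))) \<le> \<Delta>F + \<sigma>\<^sup>2 * a / L * w.W"
proof -
  define E where "E t = (LINT \<omega>|M. e t \<omega>)" for t
  define D where "D t = (LINT \<omega>|M. d t \<omega>)" for t
  define H where "H = (\<Sum>t\<le>m. \<gamma> t * (L * \<eta>\<^sup>2 / 8 * (LINT \<omega>|M. G t \<omega>)))"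
  define Q where "Q = (\<Sum>t<m. w.R (Suc t))"
  have D0: "0 \<le> D t" for t
    unfolding D_def by (rule Bochner_Integration.integral_nonneg) (rule stp_nonneg)
  have \<kappa>0: "0 < \<kappa>" using L by (intro add_pos_nonneg) auto
  have main: "H + (\<Sum>t<m. \<gamma> t * (C t * D t)) \<le> \<Delta>F + \<kappa> * (\<Sum>t\<le>m. \<gamma> t * E t)"
    unfolding H_def D_def E_def by (rule run_expected_sum_le)
  have rec: "E (Suc t) \<le> \<beta>\<^sup>2 * E t + (\<beta>\<^sup>2 * L\<^sup>2 * (\<gamma> t)\<^sup>2 * D t + a\<^sup>2 * \<sigma>\<^sup>2)" if t: "t < m" for t
    using expected_err_Suc(2)[OF t run_integrable_e[OF less_imp_le[OF t]] run_integrable_d[OF t]]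
    unfolding E_def D_def by (simp add: \<beta>_def)
  have "(\<Sum>t\<le>m. \<gamma> t * E t) \<le> w.R 0 * E 0 + (\<Sum>t<m. w.R (Suc t) * (\<beta>\<^sup>2 * L\<^sup>2 * (\<gamma> t)\<^sup>2 * D t + a\<^sup>2 * \<sigma>\<^sup>2))"
    by (rule w.sum_weighted_recursion) (rule rec)
  also have "(\<Sum>t<m. w.R (Suc t) * (\<beta>\<^sup>2 * L\<^sup>2 * (\<gamma> t)\<^sup>2 * D t + a\<^sup>2 * \<sigma>\<^sup>2))
      = (\<Sum>t<m. w.R (Suc t) * (\<beta>\<^sup>2 * L\<^sup>2 * (\<gamma> t)\<^sup>2 * D t)) + a\<^sup>2 * \<sigma>\<^sup>2 * Q"
    unfolding Q_def sum_distrib_left sum.distrib[symmetric]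
    by (intro sum.cong) (simp_all add: algebra_simps)
  finally have "\<kappa> * (\<Sum>t\<le>m. \<gamma> t * E t)
      \<le> \<kappa> * (w.R 0 * E 0 + ((\<Sum>t<m. w.R (Suc t) * (\<beta>\<^sup>2 * L\<^sup>2 * (\<gamma> t)\<^sup>2 * D t)) + a\<^sup>2 * \<sigma>\<^sup>2 * Q))"
    using \<kappa>0 by (intro mult_left_mono) auto
  then have 1: "\<kappa> * (\<Sum>t\<le>m. \<gamma> t * E t)
      \<le> \<kappa> * (w.R 0 * E 0 + a\<^sup>2 * \<sigma>\<^sup>2 * Q) + \<kappa> * (\<Sum>t<m. w.R (Suc t) * (\<beta>\<^sup>2 * L\<^sup>2 * (\<gamma> t)\<^sup>2 * D t))"
    by (simp add: distrib_left)
  have 2: "\<kappa> * (\<Sum>t<m. w.R (Suc t) * (\<beta>\<^sup>2 * L\<^sup>2 * (\<gamma> t)\<^sup>2 * D t)) \<le> (\<Sum>t<m. \<gamma> t * (C t * D t))"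
    unfolding sum_distrib_left
  proof (rule sum_mono)
    fix t assume "t \<in> {..<m}"
    then have t: "t < m" by simp
    define Z where "Z = L * (\<gamma> t)\<^sup>2 * (\<beta>\<^sup>2 * w.R (Suc t)) * D t"
    have "0 \<le> Z"
      unfolding Z_def using L D0 w.R_nonneg by (intro mult_nonneg_nonneg) auto
    \<comment> \<open>Absorption comes down to
      \<open>L * \<kappa> \<le> (1 + L\<^sup>2 * \<eta>\<^sup>2) / 2\<close>, which holds with room
      to spare since 1/3 < 1/2.\<close>
    have "L * \<kappa> = 1 / 3 + L\<^sup>2 * \<eta>\<^sup>2 / 4"
      using L by (simp add: distrib_left power2_eq_square)
    also have "\<dots> \<le> (1 + L\<^sup>2 * \<eta>\<^sup>2) / 2"
    proof -
      have "1 / 3 + u / 4 \<le> (1 + u) / 2" if "0 \<le> u" for u :: real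
        using that by simp
      from this[of "L\<^sup>2 * \<eta>\<^sup>2"] show ?thesis
        by (auto simp only: zero_le_power2 mult_nonneg_nonneg)
    qed
    finally have "L * \<kappa> * Z \<le> (1 + L\<^sup>2 * \<eta>\<^sup>2) / 2 * Z"
      using \<open>0 \<le> Z\<close> by (rule mult_right_mono)
    moreover have "\<kappa> * (w.R (Suc t) * (\<beta>\<^sup>2 * L\<^sup>2 * (\<gamma> t)\<^sup>2 * D t)) = L * \<kappa> * Z"
      unfolding Z_def by (simp add: power2_eq_square ac_simps)
    moreover have "\<gamma> t * (C t * D t) = (1 + L\<^sup>2 * \<eta>\<^sup>2) / 2 * Z"
      unfolding Z_def C_eq[OF t] by (simp add: power2_eq_square ac_simps)
    ultimately show "\<kappa> * (w.R (Suc t) * (\<beta>\<^sup>2 * L\<^sup>2 * (\<gamma> t)\<^sup>2 * D t)) \<le> \<gamma> t * (C t * D t)"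
      by (simp only:)
  qed
  define Y where "Y = a * w.W / (1 + \<beta>)"
  have Y0: "0 \<le> Y"
    unfolding Y_def using a_pos w.W_pos \<beta> by simp
  have 3: "w.R 0 * E 0 \<le> \<sigma>\<^sup>2 * (9 / 8 * Y)"
  proof -
    have "w.R 0 * E 0 \<le> w.R 0 * (\<sigma>\<^sup>2 / real b)"
      using expected_err_0(2) w.R_nonneg unfolding E_def by (intro mult_left_mono)
    \<comment> \<open>The definition of \<open>a\<close> gives 1/b = a^2 (m + 1); the factor m + 1
      is what \<open>R_0_le\<close> turns into \<open>W\<close>.\<close>
    also have "\<dots> = \<sigma>\<^sup>2 * (a\<^sup>2 * real (m + 1) * w.R 0)"
      unfolding a_sq by simp
    also have "a\<^sup>2 * real (m + 1) * w.R 0 = a / (1 + \<beta>) * ((1 - \<beta>\<^sup>2) * real (m + 1) * w.R 0)"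
      unfolding one_minus_q using \<beta> by (simp add: power2_eq_square)
    also have "\<sigma>\<^sup>2 * \<dots> \<le> \<sigma>\<^sup>2 * (a / (1 + \<beta>) * (9 / 8 * w.W))"
      using a_pos \<beta> by (intro mult_left_mono w.R_0_le) auto
    finally show ?thesis by (simp add: Y_def ac_simps)
  qed
  have 4: "a\<^sup>2 * \<sigma>\<^sup>2 * Q \<le> \<sigma>\<^sup>2 * Y"
  proof -
    have "(1 - \<beta>\<^sup>2) * Q \<le> (1 - \<beta>\<^sup>2) * (\<Sum>t\<le>m. w.R t)"
      using w.q w.R_nonneg[of 0] unfolding Q_def w.sum_R_Suc by (intro mult_left_mono) auto
    also note w.sum_R_le
    finally have "(1 - \<beta>\<^sup>2) * Q \<le> w.W" .
    then have "\<sigma>\<^sup>2 * (a / (1 + \<beta>) * ((1 - \<beta>\<^sup>2) * Q)) \<le> \<sigma>\<^sup>2 * (a / (1 + \<beta>) * w.W)"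
      using a_pos \<beta> by (intro mult_left_mono) auto
    moreover have "a / (1 + \<beta>) * ((1 - \<beta>\<^sup>2) * Q) = a\<^sup>2 * Q"
      unfolding one_minus_q using \<beta> by (simp add: power2_eq_square)
    ultimately have "\<sigma>\<^sup>2 * (a\<^sup>2 * Q) \<le> \<sigma>\<^sup>2 * (a / (1 + \<beta>) * w.W)"
      by (simp only:)
    then show ?thesis by (simp add: Y_def ac_simps)
  qed
  have "\<kappa> * (w.R 0 * E 0 + a\<^sup>2 * \<sigma>\<^sup>2 * Q) \<le> \<kappa> * (\<sigma>\<^sup>2 * (17 / 8 * Y))"
    using 3 4 \<kappa>0 by (intro mult_left_mono) (auto simp: algebra_simps)
  also have "\<dots> \<le> 7 / (12 * L) * (\<sigma>\<^sup>2 * (17 / 8 * Y))"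
  proof (rule mult_right_mono)
    have "L * \<kappa> = 1 / 3 + L\<^sup>2 * \<eta>\<^sup>2 / 4"
      using L by (simp add: distrib_left power2_eq_square)
    also have "\<dots> \<le> 7 / 12" using eta_L by simp
    finally show "\<kappa> \<le> 7 / (12 * L)" using L by (simp add: field_simps)
  qed (use Y0 in simp)
  also have "\<dots> = \<sigma>\<^sup>2 / L * (119 / 96 * Y)" by simp
  also have "\<dots> \<le> \<sigma>\<^sup>2 / L * (a * w.W)"
  proof (rule mult_left_mono)
    have "119 / 96 \<le> 1 + \<beta>" using a_le \<beta>_def by simp
    then have "119 / 96 * Y \<le> (1 + \<beta>) * Y"
      using Y0 by (rule mult_right_mono)
    also have "\<dots> = a * w.W"
      unfolding Y_def using \<beta> by simp
    finally show "119 / 96 * Y \<le> a * w.W" .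
  qed (use L in simp)
  finally have "\<kappa> * (w.R 0 * E 0 + a\<^sup>2 * \<sigma>\<^sup>2 * Q) \<le> \<sigma>\<^sup>2 * a / L * w.W" by simp
  with main 1 2 show ?thesis
    unfolding H_def by linarith
qed

text \<open>Dividing \<open>AM_HM_weights\<close> by (m + 1)^2 gives a quadratic inequality for the
  mean weight \<open>s\<close>. Its leading coefficient is at most \<open>1 / a\<close>, since
  \<open>1 - \<beta>\<^sup>2 = a * (1 + \<beta>)\<close> and
  \<open>2 * \<beta>\<^sup>2 \<le> 1 + \<beta>\<close>.\<close>

lemma weight_sum_ge:
  "\<delta> * real (m + 1) / (sqrt 2 * (L + sqrt (\<delta> * L) * (real b * real (m + 1)) powr (1/4))) \<le> w.W"
proof -
  define N where "N = real (m + 1)"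
  define s where "s = w.W / N"
  have N: "0 < N" by (simp add: N_def)
  have s: "0 < s" using w.W_pos N by (simp add: s_def)
  have W: "w.W = s * N" using N by (simp add: s_def)
  have "\<delta> / L * N\<^sup>2 \<le> s * N * (N + (1 + L\<^sup>2 * \<eta>\<^sup>2) * \<beta>\<^sup>2 / (1 - \<beta>\<^sup>2) * (s * N))"
    using w.AM_HM_weights unfolding W N_def[symmetric] .
  also have "\<dots> = (s + (1 + L\<^sup>2 * \<eta>\<^sup>2) * \<beta>\<^sup>2 / (1 - \<beta>\<^sup>2) * s\<^sup>2) * N\<^sup>2"
    by (simp add: algebra_simps power2_eq_square)
  finally have "\<delta> / L \<le> s + (1 + L\<^sup>2 * \<eta>\<^sup>2) * \<beta>\<^sup>2 / (1 - \<beta>\<^sup>2) * s\<^sup>2"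
    by (rule mult_right_le_imp_le) (rule zero_less_power[OF N])
  also have "\<dots> \<le> s + 1 / a * s\<^sup>2"
  proof (intro add_left_mono mult_right_mono)
    have "(1 + L\<^sup>2 * \<eta>\<^sup>2) * \<beta>\<^sup>2 \<le> 2 * \<beta>\<^sup>2"
      using eta_L by (intro mult_right_mono) auto
    also have "\<dots> \<le> 1 + \<beta>"
    proof -
      have "\<beta>\<^sup>2 \<le> \<beta>" using \<beta> by (simp add: power2_eq_square)
      then show ?thesis using \<beta> by linarith
    qed
    finally have "(1 + L\<^sup>2 * \<eta>\<^sup>2) * \<beta>\<^sup>2 / (1 - \<beta>\<^sup>2) \<le> (1 + \<beta>) / (1 - \<beta>\<^sup>2)"
      using w.q by (intro divide_right_mono) auto
    also have "\<dots> = 1 / a"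
      unfolding one_minus_q using \<beta> by simp
    finally show "(1 + L\<^sup>2 * \<eta>\<^sup>2) * \<beta>\<^sup>2 / (1 - \<beta>\<^sup>2) \<le> 1 / a" .
  qed simp
  finally have "\<delta> / L * L \<le> (s + 1 / a * s\<^sup>2) * L"
    using L by (intro mult_right_mono) auto
  then have "\<delta> \<le> L * s + L * s\<^sup>2 / a"
    using L by (simp add: algebra_simps)
  from mean_weight_lower_bound[OF s a_pos L delta_pos this]
  have "\<delta> / (sqrt 2 * (L + sqrt (\<delta> * L / a))) \<le> s" .
  moreover have "sqrt (\<delta> * L / a) = sqrt (\<delta> * L) * (real b * real (m + 1)) powr (1/4)"
  proof -
    have bN: "0 < real b * real (m + 1)" using b by simp
    have "\<delta> * L / a = \<delta> * L * sqrt (real b * real (m + 1))"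
      by (simp add: a_def)
    then have "sqrt (\<delta> * L / a) = sqrt (\<delta> * L) * sqrt (sqrt (real b * real (m + 1)))"
      by (simp only: real_sqrt_mult)
    also have "sqrt (sqrt (real b * real (m + 1))) = ((real b * real (m + 1)) powr (1/2)) powr (1/2)"
      using bN by (simp only: powr_half_sqrt[symmetric] less_imp_le powr_ge_zero)
    also have "\<dots> = (real b * real (m + 1)) powr (1/4)"
      by (simp add: powr_powr)
    finally show ?thesis .
  qed
  ultimately have "\<delta> / (sqrt 2 * (L + sqrt (\<delta> * L) * (real b * real (m + 1)) powr (1/4))) * N \<le> s * N"
    using N by (intro mult_right_mono) auto
  then show ?thesis
    unfolding W N_def by simp
qed

end

end

text \<open>Samples \<open>S\<close> and index \<open>T\<close> live on one space \<open>M\<close>,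
  so the expectation covers both sources of randomness. In (b) the rounding convention appears as
  equations between reals: the batch size equals its real expression, and the counts are stated
  where \<open>m + 1\<close> equals the prescribed value, while the accuracy is claimed from that
  value on.\<close>

theorem theorem2:
  fixes P :: "'s measure" and M :: "'w measure"
    and fs :: "'s \<Rightarrow> 'a::euclidean_space \<Rightarrow> real" and f :: "'a \<Rightarrow> real"
    and \<psi> F :: "'a \<Rightarrow> ereal" and Fstar :: ereal
    and L \<sigma> \<beta> \<eta> \<delta> \<Sigma>m :: real and \<gamma> :: "nat \<Rightarrow> real"
    and b m :: nat and x0 :: 'a
    and S :: "sample_label \<Rightarrow> 'w \<Rightarrow> 's" and T :: "'w \<Rightarrow> nat"
    and x :: "nat \<Rightarrow> 'w \<Rightarrow> 'a" and xbar :: "'w \<Rightarrow> 'a"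
  assumes P: "prob_space P" and M: "prob_space M"
    and smooth: "\<forall>\<xi>\<in>space P. smooth_fun (fs \<xi>)"
    and f_int: "\<forall>y. integrable P (\<lambda>\<xi>. fs \<xi> y)"
    and f_def: "f = (\<lambda>y. LINT \<xi>|P. fs \<xi> y)"
    and f_diff: "\<forall>y. f differentiable (at y)"
    and unbiased: "\<forall>y. integrable P (\<lambda>\<xi>. grad (fs \<xi>) y) \<and> (LINT \<xi>|P. grad (fs \<xi>) y) = grad f y"
    and F_def: "F = (\<lambda>y. ereal (f y) + \<psi> y)"
    and Fstar_def: "Fstar = (INF y. F y)"
    and A1: "proper_fun \<psi>" "closed_fun \<psi>" "convex_fun \<psi>" "edom F \<noteq> {}" "Fstar > - \<infinity>"
    and L: "0 < L"
    and A2: "\<forall>y\<in>edom F. \<forall>z\<in>edom F.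
        integrable P (\<lambda>\<xi>. (norm (grad (fs \<xi>) y - grad (fs \<xi>) z))\<^sup>2) \<and>
        (LINT \<xi>|P. (norm (grad (fs \<xi>) y - grad (fs \<xi>) z))\<^sup>2) \<le> L\<^sup>2 * (norm (y - z))\<^sup>2"
    and \<sigma>: "0 \<le> \<sigma>"
    and A3: "\<forall>y\<in>edom F.
        integrable P (\<lambda>\<xi>. (norm (grad (fs \<xi>) y - grad f y))\<^sup>2) \<and>
        (LINT \<xi>|P. (norm (grad (fs \<xi>) y - grad f y))\<^sup>2) \<le> \<sigma>\<^sup>2"
    and x0: "x0 \<in> edom F"
    and b: "0 < b"
    and \<beta>_def: "\<beta> = 1 - 1 / sqrt (real b * real (m + 1))" and \<beta>: "0 < \<beta>" "\<beta> < 1"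
    and \<eta>: "0 < \<eta>" "\<eta> < 1 / L"
    and \<delta>_def: "\<delta> = 2 / \<eta> - 2 * L"
    and \<gamma>_m: "\<gamma> m = \<delta> / L"
    and \<gamma>_rec: "\<forall>t<m. \<gamma> t = \<delta> / (L + L * (1 + L\<^sup>2 * \<eta>\<^sup>2) * (\<Sum>j=t+1..m. \<beta> ^ (2 * (j - t)) * \<gamma> j))"
    and \<gamma>: "\<forall>t\<le>m. 0 < \<gamma> t \<and> \<gamma> t \<le> 1"
    and samples: "iid_samples M P (sample_labels b m) S"
    and x_def: "x = (\<lambda>t \<omega>. hsgd_x fs \<psi> x0 b (\<lambda>_. \<beta>) \<gamma> (\<lambda>_. \<eta>) (\<lambda>i. S i \<omega>) t)"
    and \<Sigma>m_def: "\<Sigma>m = (\<Sum>t=0..m. \<gamma> t)"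
    and T_indep: "indep_pair M
        (count_space {0..m}) T
        (PiM (sample_labels b m) (\<lambda>_. P)) (\<lambda>\<omega>. \<lambda>i\<in>sample_labels b m. S i \<omega>)"
    and T_prob: "\<forall>t\<le>m. measure M {\<omega> \<in> space M. T \<omega> = t} = \<gamma> t / \<Sigma>m"
    and xbar_def: "xbar = (\<lambda>\<omega>. x (T \<omega>) \<omega>)"
  shows "integrable M (\<lambda>\<omega>. (norm (grad_map \<eta> f \<psi> (xbar \<omega>)))\<^sup>2) \<and>
      (LINT \<omega>|M. (norm (grad_map \<eta> f \<psi> (xbar \<omega>)))\<^sup>2)
        \<le> 8 * sqrt 2 * (L + sqrt (\<delta> * L) * (real b * real (m + 1)) powr (1/4))
             / (L * \<eta>\<^sup>2 * \<delta> * real (m + 1)) * (real_of_ereal (F x0) - real_of_ereal Fstar)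
           + 8 * \<sigma>\<^sup>2 / (L\<^sup>2 * \<eta>\<^sup>2 * sqrt (real b * real (m + 1)))
    \<and>
      (\<forall>c1 \<epsilon> \<Delta>0 :: real.
        c1 \<ge> 1 / real (m + 1) powr (2/3) \<longrightarrow>
        real b = c1\<^sup>2 * real (m + 1) powr (1/3) \<longrightarrow>
        \<epsilon> > 0 \<longrightarrow>
        \<Delta>0 = 8 / (L\<^sup>2 * \<eta>\<^sup>2) *
          (sqrt 2 * L * (L + sqrt (c1 * L * \<delta>)) / \<delta> * (real_of_ereal (F x0) - real_of_ereal Fstar)
           + \<sigma>\<^sup>2 / c1) \<longrightarrow>
        (real (m + 1) \<ge> \<Delta>0 powr (3/2) / \<epsilon> ^ 3 \<longrightarrow>
           (LINT \<omega>|M. (norm (grad_map \<eta> f \<psi> (xbar \<omega>)))\<^sup>2) \<le> \<epsilon>\<^sup>2) \<and>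
        (real (m + 1) = \<Delta>0 powr (3/2) / \<epsilon> ^ 3 \<longrightarrow>
           int m \<le> \<lfloor>\<Delta>0 powr (3/2) / \<epsilon> ^ 3\<rfloor> \<and>
           int (prox_ops m) = \<lfloor>\<Delta>0 powr (3/2) / \<epsilon> ^ 3\<rfloor> \<and>
           int (sgrad_evals b m) \<le>
             \<lfloor>c1\<^sup>2 * \<Delta>0 powr (1/2) / \<epsilon> + 3 * \<Delta>0 powr (3/2) / \<epsilon> ^ 3\<rfloor>))"
proof -
  interpret P: prob_space P by (rule P)
  interpret M: prob_space M by (rule M)
  have edom_F: "edom F = edom \<psi>"
  proof -
    have "F y < \<infinity> \<longleftrightarrow> \<psi> y < \<infinity>" for y
      unfolding F_def by (cases "\<psi> y") auto
    then show ?thesis by (simp add: edom_def)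
  qed
  define Flow where "Flow = real_of_ereal Fstar"
  have F_real: "F y = ereal (f y + real_of_ereal (\<psi> y))" if "y \<in> edom \<psi>" for y
    unfolding F_def using edom_real[OF A1(1) that] by (metis plus_ereal.simps(1))
  have Fstar_le: "Fstar \<le> F y" for y
    unfolding Fstar_def by (rule INF_lower) simp
  have Fstar_real: "Fstar = ereal Flow"
    using A1(5) Fstar_le[of x0] x0 unfolding Flow_def edom_def by (cases Fstar) auto
  have low: "Flow \<le> f y + real_of_ereal (\<psi> y)" if "y \<in> edom \<psi>" for y
    using Fstar_le[of y] unfolding Fstar_real F_real[OF that] by simp
  \<comment> \<open>Jensen: averaging the sampled gradients preserves the Lipschitz constant on the
    domain of \<open>\<psi>\<close>.\<close>
  have lip: "norm (grad f y - grad f z) \<le> L * norm (y - z)" if "y \<in> edom \<psi>" "z \<in> edom \<psi>" for y z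
  proof -
    let ?Z = "\<lambda>\<xi>. grad (fs \<xi>) y - grad (fs \<xi>) z"
    have Z: "integrable P ?Z" "(LINT \<xi>|P. ?Z \<xi>) = grad f y - grad f z"
      using unbiased by simp_all
    have Z2: "integrable P (\<lambda>\<xi>. (norm (?Z \<xi>))\<^sup>2)"
      "(LINT \<xi>|P. (norm (?Z \<xi>))\<^sup>2) \<le> L\<^sup>2 * (norm (y - z))\<^sup>2"
      using A2 that unfolding edom_F by blast+
    have "0 \<le> (LINT \<xi>|P. (norm (?Z \<xi> - (grad f y - grad f z)))\<^sup>2)"
      by (rule Bochner_Integration.integral_nonneg) simp
    then have "(norm (grad f y - grad f z))\<^sup>2 \<le> (L * norm (y - z))\<^sup>2"
      using P.variance_le_second_moment(4)[OF Z(1) Z2(1)] Z2(2) unfolding Z(2) power_mult_distrib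
      by linarith
    then show ?thesis
      by (rule power2_le_imp_le) (use L in simp)
  qed
  have \<eta>L: "\<eta> * L < 1"
    using \<eta> L by (simp add: field_simps)
  interpret hsgd_run f \<psi> L \<eta> Flow P fs \<sigma> \<beta> \<gamma> b m x0 M S
  proof (unfold_locales)
    show "\<And>\<xi>. \<xi> \<in> space P \<Longrightarrow> continuous_on UNIV (grad (fs \<xi>))"
      using smooth by (simp add: smooth_fun_def)
  qed (use f_diff A1 L \<eta> \<eta>L lip low unbiased A2 A3 x0 b \<gamma> samples in \<open>simp_all add: edom_F\<close>)
  define a where "a = 1 / sqrt (real b * real (m + 1))"
  define W where "W = (\<Sum>t\<le>m. \<gamma> t)"
  have \<beta>a: "\<beta> = 1 - a"
    by (simp add: \<beta>_def a_def)
  note G_int = run_integrable_G[OF a_def \<beta>a \<beta> \<delta>_def \<gamma>_m \<gamma>_rec]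
  note G_sum = weighted_gradient_mapping_le[OF a_def \<beta>a \<beta> \<delta>_def \<gamma>_m \<gamma>_rec, folded W_def]
  note W_ge = weight_sum_ge[OF a_def \<beta>a \<beta> \<delta>_def \<gamma>_m \<gamma>_rec, folded W_def]
  note \<delta>0 = delta_pos[OF a_def \<beta>a \<beta> \<delta>_def \<gamma>_m \<gamma>_rec]
  have W_pos: "0 < W"
    unfolding W_def using \<gamma> by (intro sum_pos) auto
  have T_le: "T \<omega> \<le> m" if "\<omega> \<in> space M" for \<omega>
    using T_indep measurable_space[of T M "count_space {0..m}" \<omega>] that by (simp add: indep_pair_def)
  have ind: "indep_pair M (count_space {0..m}) T (Pi\<^sub>M (sample_labels b m) (\<lambda>_. P)) (smp m)"
    using T_indep by (simp add: smp_def[abs_def])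
  \<comment> \<open>The random output becomes a function of the index and the restricted sample
    tuple, the two variables assumed independent.\<close>
  have xbar: "(norm (grad_map \<eta> f \<psi> (xbar \<omega>)))\<^sup>2 = gmap (T \<omega>) (smp m \<omega>)" if "\<omega> \<in> space M" for \<omega>
    unfolding eval_smp(3)[OF T_le[OF that]] unfolding gmap_def xbar_def x_def ..
  have h_meas: "gmap t \<in> borel_measurable (Pi\<^sub>M (sample_labels b m) (\<lambda>_. P))" if "t \<le> m" for t
    by (rule measurable_err_stp_gmap(3)[OF sample_labels_mono[OF that]])
  have h_int: "integrable M (\<lambda>\<omega>. gmap t (smp m \<omega>))" if "t \<le> m" for t
    unfolding eval_smp(3)[OF that] by (rule G_int[OF that])
  have index: "integrable M (\<lambda>\<omega>. gmap (T \<omega>) (smp m \<omega>))"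
    "(LINT \<omega>|M. gmap (T \<omega>) (smp m \<omega>))
      = (\<Sum>t\<le>m. measure M {\<omega> \<in> space M. T \<omega> = t} * (LINT \<omega>|M. gmap t (smp m \<omega>)))"
    by (rule M.random_index_expectation[where h=gmap, OF ind]; rule h_meas h_int; assumption)+
  have int: "integrable M (\<lambda>\<omega>. (norm (grad_map \<eta> f \<psi> (xbar \<omega>)))\<^sup>2)"
    using index(1) by (subst Bochner_Integration.integrable_cong[OF refl xbar]) auto
  define \<Delta> where "\<Delta> = real_of_ereal (F x0) - real_of_ereal Fstar"
  have x0d: "x0 \<in> edom \<psi>" using x0 edom_F by simp
  have \<Delta>: "\<Delta> = \<Delta>F"
    unfolding \<Delta>_def F_real[OF x0d] Flow_def by simp
  have \<Delta>0: "0 \<le> \<Delta>"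
    unfolding \<Delta> using low[OF x0d] by simp
  define Q where "Q = L + sqrt (\<delta> * L) * (real b * real (m + 1)) powr (1/4)"
  have Q: "0 < Q"
    unfolding Q_def using L \<delta>0 by (intro add_pos_nonneg) auto
  have bound: "(LINT \<omega>|M. (norm (grad_map \<eta> f \<psi> (xbar \<omega>)))\<^sup>2)
      \<le> 8 * sqrt 2 * Q / (L * \<eta>\<^sup>2 * \<delta> * real (m + 1)) * \<Delta>
        + 8 * \<sigma>\<^sup>2 / (L\<^sup>2 * \<eta>\<^sup>2 * sqrt (real b * real (m + 1)))"
  proof -
    have "(LINT \<omega>|M. (norm (grad_map \<eta> f \<psi> (xbar \<omega>)))\<^sup>2) = (LINT \<omega>|M. gmap (T \<omega>) (smp m \<omega>))"
      by (rule Bochner_Integration.integral_cong[OF refl xbar])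
    also have "\<dots> = (\<Sum>t\<le>m. measure M {\<omega> \<in> space M. T \<omega> = t} * (LINT \<omega>|M. gmap t (smp m \<omega>)))"
      by (rule index(2))
    also have "\<dots> = (\<Sum>t\<le>m. 8 / (L * \<eta>\<^sup>2 * W) * (\<gamma> t * (L * \<eta>\<^sup>2 / 8 * (LINT \<omega>|M. G t \<omega>))))"
    proof (rule sum.cong)
      fix t assume "t \<in> {..m}"
      then have t: "t \<le> m" by simp
      have "measure M {\<omega> \<in> space M. T \<omega> = t} = \<gamma> t / W"
        using T_prob t by (simp add: \<Sigma>m_def W_def atMost_atLeast0)
      then show "measure M {\<omega> \<in> space M. T \<omega> = t} * (LINT \<omega>|M. gmap t (smp m \<omega>))
          = 8 / (L * \<eta>\<^sup>2 * W) * (\<gamma> t * (L * \<eta>\<^sup>2 / 8 * (LINT \<omega>|M. G t \<omega>)))"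
        unfolding eval_smp(3)[OF t] using L \<eta> by simp
    qed simp
    also have "\<dots> = 8 / (L * \<eta>\<^sup>2 * W) * (\<Sum>t\<le>m. \<gamma> t * (L * \<eta>\<^sup>2 / 8 * (LINT \<omega>|M. G t \<omega>)))"
      by (rule sum_distrib_left[symmetric])
    also have "\<dots> \<le> 8 / (L * \<eta>\<^sup>2 * W) * (\<Delta> + \<sigma>\<^sup>2 * a / L * W)"
      unfolding \<Delta> using G_sum L \<eta> W_pos by (intro mult_left_mono) auto
    also have "\<dots> = 8 / (L * \<eta>\<^sup>2) * (1 / W * \<Delta>) + 8 * \<sigma>\<^sup>2 / (L\<^sup>2 * \<eta>\<^sup>2) * a"
      using W_pos L by (simp only: distrib_left) (simp add: power2_eq_square mult.left_commute mult.commute)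
    \<comment> \<open>Only the objective gap is still divided by \<open>W\<close>, and here its
      lower bound enters; in the noise term \<open>W\<close> has cancelled.\<close>
    also have "8 / (L * \<eta>\<^sup>2) * (1 / W * \<Delta>) \<le> 8 / (L * \<eta>\<^sup>2) * (sqrt 2 * Q / (\<delta> * real (m + 1)) * \<Delta>)"
    proof (intro mult_left_mono mult_right_mono \<Delta>0)
      have W_ge': "\<delta> * real (m + 1) / (sqrt 2 * Q) \<le> W"
        unfolding Q_def by (rule W_ge)
      have "0 < \<delta> * real (m + 1) / (sqrt 2 * Q)"
        using \<delta>0 Q by (intro divide_pos_pos mult_pos_pos) auto
      then have "1 / W \<le> 1 / (\<delta> * real (m + 1) / (sqrt 2 * Q))"
        by (rule frac_le[OF zero_le_one order_refl _ W_ge'])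
      then show "1 / W \<le> sqrt 2 * Q / (\<delta> * real (m + 1))"
        by simp
    qed (use L in simp)
    also have "8 / (L * \<eta>\<^sup>2) * (sqrt 2 * Q / (\<delta> * real (m + 1)) * \<Delta>)
        = 8 * sqrt 2 * Q / (L * \<eta>\<^sup>2 * \<delta> * real (m + 1)) * \<Delta>"
      by (simp add: mult.assoc)
    also have "8 * \<sigma>\<^sup>2 / (L\<^sup>2 * \<eta>\<^sup>2) * a = 8 * \<sigma>\<^sup>2 / (L\<^sup>2 * \<eta>\<^sup>2 * sqrt (real b * real (m + 1)))"
      by (simp add: a_def)
    finally show ?thesis by simp
  qed
  have complexity: "(real (m + 1) \<ge> D powr (3/2) / \<epsilon> ^ 3 \<longrightarrow>
         (LINT \<omega>|M. (norm (grad_map \<eta> f \<psi> (xbar \<omega>)))\<^sup>2) \<le> \<epsilon>\<^sup>2) \<and>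
      (real (m + 1) = D powr (3/2) / \<epsilon> ^ 3 \<longrightarrow>
         int m \<le> \<lfloor>D powr (3/2) / \<epsilon> ^ 3\<rfloor> \<and>
         int (prox_ops m) = \<lfloor>D powr (3/2) / \<epsilon> ^ 3\<rfloor> \<and>
         int (sgrad_evals b m) \<le> \<lfloor>c1\<^sup>2 * D powr (1/2) / \<epsilon> + 3 * D powr (3/2) / \<epsilon> ^ 3\<rfloor>)"
    if c1: "c1 \<ge> 1 / real (m + 1) powr (2/3)" and bc: "real b = c1\<^sup>2 * real (m + 1) powr (1/3)"
      and \<epsilon>: "\<epsilon> > 0"
      and D: "D = 8 / (L\<^sup>2 * \<eta>\<^sup>2) * (sqrt 2 * L * (L + sqrt (c1 * L * \<delta>)) / \<delta> * \<Delta> + \<sigma>\<^sup>2 / c1)"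
    for c1 \<epsilon> D :: real
  proof (intro conjI impI)
    have N: "1 \<le> real (m + 1)" by simp
    have "0 < 1 / real (m + 1) powr (2/3)" by simp
    with c1 have c1': "0 < c1" by linarith
    have D0: "0 \<le> D"
      unfolding D using L \<delta>0 \<Delta>0 c1' by (intro mult_nonneg_nonneg add_nonneg_nonneg divide_nonneg_nonneg) auto
    show "(LINT \<omega>|M. (norm (grad_map \<eta> f \<psi> (xbar \<omega>)))\<^sup>2) \<le> \<epsilon>\<^sup>2"
      if le: "D powr (3/2) / \<epsilon> ^ 3 \<le> real (m + 1)"
    proof -
      note bound
      also have "8 * sqrt 2 * Q / (L * \<eta>\<^sup>2 * \<delta> * real (m + 1)) * \<Delta>
          + 8 * \<sigma>\<^sup>2 / (L\<^sup>2 * \<eta>\<^sup>2 * sqrt (real b * real (m + 1))) \<le> D / real (m + 1) powr (2/3)"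
        unfolding Q_def D by (rule complexity_rate[OF L \<eta>(1) \<delta>0 \<Delta>0 c1' N bc])
      also have "\<dots> \<le> \<epsilon>\<^sup>2"
        using N by (intro accuracy_of_iteration_count[OF D0 \<epsilon> _ le]) linarith
      finally show ?thesis .
    qed
    assume eq: "real (m + 1) = D powr (3/2) / \<epsilon> ^ 3"
    show "int (prox_ops m) = \<lfloor>D powr (3/2) / \<epsilon> ^ 3\<rfloor>"
      unfolding eq[symmetric] prox_ops_def by (simp only: floor_of_nat)
    show "int m \<le> \<lfloor>D powr (3/2) / \<epsilon> ^ 3\<rfloor>"
      unfolding eq[symmetric] by simp
    \<comment> \<open>The real expression under the floor turns out to be the integer count itself,
      so taking the floor loses nothing.\<close>
    have "c1\<^sup>2 * D powr (1/2) / \<epsilon> = real b"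
      unfolding bc iteration_count_cube_root[OF D0 \<epsilon> eq] by simp
    moreover have "3 * D powr (3/2) / \<epsilon> ^ 3 = 3 * real (m + 1)"
      unfolding eq by simp
    ultimately have "c1\<^sup>2 * D powr (1/2) / \<epsilon> + 3 * D powr (3/2) / \<epsilon> ^ 3 = real (sgrad_evals b m)"
      by (simp add: sgrad_evals_def)
    then show "int (sgrad_evals b m) \<le> \<lfloor>c1\<^sup>2 * D powr (1/2) / \<epsilon> + 3 * D powr (3/2) / \<epsilon> ^ 3\<rfloor>"
      by simp
  qed
  show ?thesis
    using int bound complexity unfolding \<Delta>_def[symmetric] Q_def[symmetric] by blast
qed

end
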